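(* Let $R$ be a complete intersection SAGA of codimension $n+1$ presented by quadrics, let $k\ge2$, and let $\pi\subseteq\mathbb P(R^1)$ be a $(k-1)$-dimensional linear subspace contained in $\mathcal N_{k+1}$. Then: (A) $T_k:=\pi\cap\mathcal N_k$ is a hypersurface of degree $k$ in $\pi$ (the zero locus of a nonzero homogeneous form of degree $k$ on $\pi$, possibly with multiple components); (B) there exist $[x_0],\dots,[x_{k-1}]\in T_k$ with $x_0,\dots,x_{k-1}$ linearly independent and $\prod_{i=0}^{k-1}x_i\neq0$. In particular $T_k$ is non-degenerate in $\pi$ and $\pi\subseteq\mathrm{Sec}^k(\mathcal N_k)$.
   Context: $\mathbb K$ is an algebraically closed field of characteristic $0$. A complete intersection SAGA of codimension $n+1$ presented by quadrics is $R=S/I$ with $S=\mathbb K[x_0,\dots,x_n]$ and $I$ generated by a regular sequence of $n+1$ homogeneous quadrics. $\mathcal N_k=\{[x]\in\mathbb P(R^1)\mid x^k=0\}$. For nonempty $X\subseteq\mathbb P^r$, $\mathrm{Sec}^k(X)$ is the closure of $\bigcup_{p_1,\dots,p_k\in X}\langle p_1,\dots,p_k\rangle$, where $\langle\cdot\rangle$ denotes linear span. *)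

theory Defs
  imports "HOL-Library.Poly_Mapping" "HOL-Computational_Algebra.Polynomial"
begin

text \<open>Multivariate polynomials over 'a in variables indexed by nat, as finitely
supported functions from monomials (exponent vectors) to coefficients.\<close>
type_synonym 'a mpoly = "(nat \<Rightarrow>\<^sub>0 nat) \<Rightarrow>\<^sub>0 'a"

definition alg_closed :: "'a::field itself \<Rightarrow> bool" where
  "alg_closed _ \<longleftrightarrow> (\<forall>p :: 'a poly. degree p > 0 \<longrightarrow> (\<exists>x. poly p x = 0))"

definition mdeg :: "(nat \<Rightarrow>\<^sub>0 nat) \<Rightarrow> nat" where
  "mdeg m = (\<Sum>v\<in>Poly_Mapping.keys m. Poly_Mapping.lookup m v)"

definition in_vars :: "nat \<Rightarrow> 'a::zero mpoly \<Rightarrow> bool" where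
  "in_vars N f \<longleftrightarrow> (\<forall>m\<in>Poly_Mapping.keys f. Poly_Mapping.keys m \<subseteq> {..<N})"

definition homog :: "nat \<Rightarrow> 'a::zero mpoly \<Rightarrow> bool" where
  "homog d f \<longleftrightarrow> (\<forall>m\<in>Poly_Mapping.keys f. mdeg m = d)"

definition const :: "'a::zero \<Rightarrow> 'a mpoly" where
  "const c = Poly_Mapping.single 0 c"

definition var :: "nat \<Rightarrow> 'a::{zero,one} mpoly" where
  "var i = Poly_Mapping.single (Poly_Mapping.single i 1) 1"

definition meval :: "'a::comm_semiring_1 mpoly \<Rightarrow> (nat \<Rightarrow> 'a) \<Rightarrow> 'a" where
  "meval f c = (\<Sum>m\<in>Poly_Mapping.keys f. Poly_Mapping.lookup f m * (\<Prod>v\<in>Poly_Mapping.keys m. c v ^ Poly_Mapping.lookup m v))"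

definition gen_ideal :: "nat \<Rightarrow> (nat \<Rightarrow> 'a::comm_ring_1 mpoly) \<Rightarrow> nat \<Rightarrow> 'a mpoly set" where
  "gen_ideal N q j = {(\<Sum>i<j. a i * q i) | a. \<forall>i<j. in_vars N (a i)}"

definition regular_seq :: "nat \<Rightarrow> (nat \<Rightarrow> 'a::comm_ring_1 mpoly) \<Rightarrow> nat \<Rightarrow> bool" where
  "regular_seq N q r \<longleftrightarrow>
     1 \<notin> gen_ideal N q r \<and>
     (\<forall>j<r. \<forall>f. in_vars N f \<longrightarrow> f * q j \<in> gen_ideal N q j \<longrightarrow> f \<in> gen_ideal N q j)"

definition lin_indep :: "nat \<Rightarrow> (nat \<Rightarrow> 'a::comm_ring_1 mpoly) \<Rightarrow> bool" where
  "lin_indep k x \<longleftrightarrow> (\<forall>c. (\<Sum>i<k. const (c i) * x i) = 0 \<longrightarrow> (\<forall>i<k. c i = 0))"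

definition lincomb :: "nat \<Rightarrow> (nat \<Rightarrow> 'a::comm_ring_1 mpoly) \<Rightarrow> (nat \<Rightarrow> 'a) \<Rightarrow> 'a mpoly" where
  "lincomb k b c = (\<Sum>i<k. const (c i) * b i)"

end

theory Submission
  imports Defs "HOL-Library.FuncSet"
begin

text \<open>
Let \<open>W\<close> be the span of the \<open>k\<close> linear forms \<open>b i\<close> and \<open>R = S / I\<close>. By polarization the
hypothesis says that \<open>W\<close> annihilates the image of \<open>Sym\<^sup>k W\<close> in \<open>R\<close>, so everything rests on
the annihilator of \<open>W\<close> in \<open>R\<close>. This annihilator is the Koszul homology
\<open>H\<^sub>k(b; R) = Tor\<^sub>k(S / (b), S / I) = H\<^sub>k(q; S / (b))\<close>; moving from the first description to the
last lowers polynomial degrees by \<open>k\<close>. Hence it vanishes in degrees below \<open>k\<close>, and in degree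
\<open>k\<close> it consists of constant cycles, which form a space of dimension at most one.

Consequently \<open>y\<^sup>k = F(y) w\<close> on \<open>W\<close> for a fixed \<open>w\<close>, with \<open>F\<close> a form of degree \<open>k\<close>. If
\<open>x \<in> W\<close> satisfies \<open>x y\<^sup>k\<^sup>-\<^sup>1 = 0\<close> for all \<open>y \<in> W\<close>, then descending through the degrees below
\<open>k\<close> gives \<open>x = 0\<close>. This shows \<open>F \<noteq> 0\<close>, and also that the zero set of \<open>F\<close> is not contained in
the union of two hyperplanes having a common direction: \<open>F\<close> would have no zeros on generic lines
in such a direction, hence be constant along them. The independent zeros of \<open>F\<close> with nonzero product
are then chosen one after the other, each outside the span of the previous ones and outside the
hyperplane on which the product becomes zero.
\<close>

subsection \<open>Multivariate polynomials\<close>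

lemma sum_single_keys: "f = (\<Sum>m\<in>Poly_Mapping.keys f. Poly_Mapping.single m (Poly_Mapping.lookup f m))"
  by (rule poly_mapping_eqI) (auto simp: lookup_sum lookup_single when_def sum.delta in_keys_iff)

lemma mpoly_single_induct [case_names zero add]:
  fixes f :: "'a::comm_monoid_add mpoly"
  assumes "P 0" "\<And>m c f. P f \<Longrightarrow> P (Poly_Mapping.single m c + f)"
  shows "P f"
proof -
  have "finite A \<Longrightarrow> P (\<Sum>m\<in>A. Poly_Mapping.single m (Poly_Mapping.lookup f m))" for A
    by (induction A rule: finite_induct) (auto intro: assms)
  from this[OF finite_keys] show ?thesis using sum_single_keys[of f] by metis
qed

lemma const_0 [simp]: "const 0 = 0" and const_1 [simp]: "const 1 = 1"
  by (simp_all add: const_def)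

lemma const_add [simp]: "const (a + b) = const a + const b"
  by (simp add: const_def single_add)

lemma const_mult [simp]: "const (a * b) = const a * const b"
  by (simp add: const_def mult_single)

lemma const_ring_simps [simp]:
  fixes a :: "'a::comm_ring_1"
  shows "const (- a) = - const a" "const (a - b) = const a - const b" "const (a ^ n) = const a ^ n"
  by (simp_all add: const_def single_uminus single_diff) (induction n, simp_all add: mult_single flip: const_def)

lemma const_sum: "const (sum f A) = (\<Sum>x\<in>A. const (f x))"
  by (induction A rule: infinite_finite_induct) simp_all

lemma const_prod: "const (prod f A :: 'a::comm_semiring_1) = (\<Prod>x\<in>A. const (f x))"
  by (induction A rule: infinite_finite_induct) simp_all

lemma const_eq_0_iff [simp]: "const a = 0 \<longleftrightarrow> a = 0"
  by (metis const_def lookup_single_eq lookup_zero single_zero)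

section \<open>Evaluation homomorphisms\<close>

definition mono_eval :: "(nat \<Rightarrow> 'b::comm_semiring_1) \<Rightarrow> (nat \<Rightarrow>\<^sub>0 nat) \<Rightarrow> 'b" where
  "mono_eval s m = (\<Prod>v\<in>Poly_Mapping.keys m. s v ^ Poly_Mapping.lookup m v)"

text \<open>The coefficient map \<open>h\<close> lets one construction serve both for evaluation at
  scalars (\<open>h = id\<close>) and for substitution of polynomials
  (\<open>h = const\<close>).\<close>

definition eval_hom :: "('a::zero \<Rightarrow> 'b::comm_semiring_1) \<Rightarrow> (nat \<Rightarrow> 'b) \<Rightarrow> 'a mpoly \<Rightarrow> 'b" where
  "eval_hom h s f = (\<Sum>m\<in>Poly_Mapping.keys f. h (Poly_Mapping.lookup f m) * mono_eval s m)"

lemma mono_eval_superset: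
  assumes "finite V" "Poly_Mapping.keys m \<subseteq> V"
  shows "mono_eval s m = (\<Prod>v\<in>V. s v ^ Poly_Mapping.lookup m v)"
  unfolding mono_eval_def using assms by (intro prod.mono_neutral_left) (auto simp: in_keys_iff)

lemma mono_eval_add: "mono_eval s (m + m') = mono_eval s m * mono_eval s m'"
proof -
  let ?V = "Poly_Mapping.keys m \<union> Poly_Mapping.keys m'"
  have "Poly_Mapping.keys (m + m') \<subseteq> ?V" by (rule keys_add)
  then show ?thesis
    by (simp add: mono_eval_superset[of ?V] lookup_add power_add prod.distrib)
qed

lemma eval_hom_superset:
  assumes "h 0 = 0" "finite K" "Poly_Mapping.keys f \<subseteq> K"
  shows "eval_hom h s f = (\<Sum>m\<in>K. h (Poly_Mapping.lookup f m) * mono_eval s m)"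
  unfolding eval_hom_def using assms by (intro sum.mono_neutral_left) (auto simp: in_keys_iff)

lemma eval_hom_single: "h 0 = 0 \<Longrightarrow> eval_hom h s (Poly_Mapping.single m c) = h c * mono_eval s m"
  by (subst eval_hom_superset[where K="{m}"]) auto

lemma eval_hom_add:
  assumes h0: "h 0 = 0" and "\<And>a b. h (a + b) = h a + h b"
  shows "eval_hom h s (f + g) = eval_hom h s f + eval_hom h s g"
proof -
  let ?K = "Poly_Mapping.keys f \<union> Poly_Mapping.keys g"
  have "Poly_Mapping.keys (f + g) \<subseteq> ?K" by (rule keys_add)
  then show ?thesis
    by (simp add: eval_hom_superset[of h ?K, OF h0] lookup_add assms(2) sum.distrib distrib_right)
qed

lemma eval_hom_zero: "eval_hom h s 0 = 0"
  by (simp add: eval_hom_def)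

lemma eval_hom_mult:
  fixes f :: "'a::comm_semiring_1 mpoly"
  assumes "h 0 = 0" "\<And>a b. h (a + b) = h a + h b" "\<And>a b. h (a * b) = h a * h b"
  shows "eval_hom h s (f * g) = eval_hom h s f * eval_hom h s g"
proof (induction f rule: mpoly_single_induct)
  case zero
  then show ?case by (simp add: eval_hom_zero)
next
  case (add m c f)
  have "eval_hom h s (Poly_Mapping.single m c * g) = eval_hom h s (Poly_Mapping.single m c) * eval_hom h s g"
  proof (induction g rule: mpoly_single_induct)
    case zero
    then show ?case by (simp add: eval_hom_zero)
  next
    case (add m' c' g)
    then show ?case
      by (simp add: distrib_left eval_hom_add[OF assms(1,2)] eval_hom_single[of h, OF assms(1)]
          mult_single assms(3) mono_eval_add ac_simps)
  qed
  then show ?case using add by (simp add: distrib_right eval_hom_add[OF assms(1,2)])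
qed

lemma mono_eval_single [simp]: "mono_eval s (Poly_Mapping.single i (Suc 0)) = s i"
  by (simp add: mono_eval_def)

lemma mono_eval_zero [simp]: "mono_eval s 0 = 1"
  by (simp add: mono_eval_def)

lemma meval_eq: "meval f c = eval_hom id c f"
  by (simp add: meval_def eval_hom_def mono_eval_def)

lemma meval_add: "meval (f + g) c = meval f c + meval g c"
  by (simp add: meval_eq eval_hom_add)

lemma meval_mult: "meval (f * g) c = meval f c * meval g c"
  by (simp add: meval_eq eval_hom_mult)

lemma meval_const [simp]: "meval (const a) c = a"
  by (simp add: meval_eq const_def eval_hom_single)

lemma meval_var [simp]: "meval (var i) c = c i"
  by (simp add: meval_eq var_def eval_hom_single)

lemma meval_sum: "meval (sum f A) c = (\<Sum>x\<in>A. meval (f x) c)"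
  by (induction A rule: infinite_finite_induct) (simp_all add: meval_add, simp_all add: meval_eq eval_hom_zero)

lemma meval_prod: "meval (prod f A) c = (\<Prod>x\<in>A. meval (f x) c)"
  by (induction A rule: infinite_finite_induct) (simp_all add: meval_mult meval_const[of 1, simplified])

section \<open>Bounded variables and homogeneity\<close>

lemma in_vars_0 [simp]: "in_vars N 0" and in_vars_const [simp]: "in_vars N (const c)"
  and in_vars_var [simp]: "i < N \<Longrightarrow> in_vars N (var i :: 'a::{zero,one} mpoly)"
  by (auto simp: in_vars_def const_def var_def)

lemma in_vars_1 [simp]: "in_vars N (1 :: 'a::comm_semiring_1 mpoly)"
  using in_vars_const[of N "1::'a"] by (simp del: in_vars_const)

lemma in_vars_add [intro, simp]: "in_vars N f \<Longrightarrow> in_vars N g \<Longrightarrow> in_vars N (f + g)"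
  unfolding in_vars_def using keys_add[of f g] by blast

lemma in_vars_mult [intro, simp]:
  assumes "in_vars N (f :: 'a::comm_semiring_1 mpoly)" "in_vars N g" shows "in_vars N (f * g)"
proof -
  have "Poly_Mapping.keys (a + b) \<subseteq> {..<N}"
    if "a \<in> Poly_Mapping.keys f" "b \<in> Poly_Mapping.keys g" for a b
    using assms that keys_add[of a b] unfolding in_vars_def by blast
  then show ?thesis unfolding in_vars_def using keys_mult[of f g] by blast
qed

lemma in_vars_uminus [simp]: "in_vars N (- f :: 'a::comm_ring_1 mpoly) \<longleftrightarrow> in_vars N f"
  by (simp add: in_vars_def)

lemma in_vars_diff [intro, simp]: "in_vars N f \<Longrightarrow> in_vars N g \<Longrightarrow> in_vars N (f - g :: 'a::comm_ring_1 mpoly)"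
  using in_vars_add[of N f "- g"] by simp

lemma in_vars_sum [intro]: "(\<And>x. x \<in> A \<Longrightarrow> in_vars N (f x)) \<Longrightarrow> in_vars N (sum f A)"
  by (induction A rule: infinite_finite_induct) auto

lemma in_vars_prod [intro]:
  "(\<And>x. x \<in> A \<Longrightarrow> in_vars N (f x)) \<Longrightarrow> in_vars N (prod f A :: 'a::comm_semiring_1 mpoly)"
  by (induction A rule: infinite_finite_induct) auto

lemma in_vars_power [intro, simp]: "in_vars N f \<Longrightarrow> in_vars N (f ^ n :: 'a::comm_semiring_1 mpoly)"
  by (induction n) auto

lemma mdeg_superset:
  "finite V \<Longrightarrow> Poly_Mapping.keys m \<subseteq> V \<Longrightarrow> mdeg m = (\<Sum>v\<in>V. Poly_Mapping.lookup m v)"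
  unfolding mdeg_def by (intro sum.mono_neutral_left) (auto simp: in_keys_iff)

lemma mdeg_add: "mdeg (m + m') = mdeg m + mdeg m'"
proof -
  let ?V = "Poly_Mapping.keys m \<union> Poly_Mapping.keys m'"
  have "Poly_Mapping.keys (m + m') \<subseteq> ?V" by (rule keys_add)
  then show ?thesis
    by (simp add: mdeg_superset[of ?V] lookup_add sum.distrib)
qed

lemma homog_0 [simp]: "homog d 0" and homog_const [simp]: "homog 0 (const c)"
  and homog_var [simp]: "homog 1 (var i :: 'a::{zero,one} mpoly)"
  by (auto simp: homog_def const_def var_def mdeg_def)

lemma homog_add [intro, simp]: "homog d f \<Longrightarrow> homog d g \<Longrightarrow> homog d (f + g)"
  unfolding homog_def using keys_add[of f g] by blast

lemma homog_uminus [simp]: "homog d (- f :: 'a::comm_ring_1 mpoly) \<longleftrightarrow> homog d f"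
  by (simp add: homog_def)

lemma homog_diff [intro, simp]: "homog d f \<Longrightarrow> homog d g \<Longrightarrow> homog d (f - g :: 'a::comm_ring_1 mpoly)"
  using homog_add[of d f "- g"] by simp

lemma homog_mult [intro]:
  assumes "homog d (f :: 'a::comm_semiring_1 mpoly)" "homog e g"
  shows "homog (d + e) (f * g)"
proof -
  have "mdeg (a + b) = d + e"
    if "a \<in> Poly_Mapping.keys f" "b \<in> Poly_Mapping.keys g" for a b
    using assms that by (simp add: mdeg_add homog_def)
  then show ?thesis unfolding homog_def using keys_mult[of f g] by blast
qed

lemma homog_const_mult [intro, simp]: "homog d f \<Longrightarrow> homog d (const c * f :: 'a::comm_semiring_1 mpoly)"
  using homog_mult[OF homog_const[of c], of d f] by simp

lemma homog_sum [intro]: "(\<And>x. x \<in> A \<Longrightarrow> homog d (f x)) \<Longrightarrow> homog d (sum f A)"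
  by (induction A rule: infinite_finite_induct) auto

lemma homog_prod:
  "finite A \<Longrightarrow> (\<And>x. x \<in> A \<Longrightarrow> homog 1 (f x)) \<Longrightarrow> homog (card A) (prod f A :: 'a::comm_semiring_1 mpoly)"
proof (induction A rule: finite_induct)
  case empty
  then show ?case using homog_const[of "1::'a"] by (simp del: homog_const)
next
  case (insert x F)
  then show ?case using homog_mult[of 1 "f x" "card F" "prod f F"] by simp
qed

lemma homog_power: "homog 1 f \<Longrightarrow> homog n (f ^ n :: 'a::comm_semiring_1 mpoly)"
  using homog_prod[of "{..<n}" "\<lambda>_. f"] by simp

section \<open>Homogeneous components\<close>

lift_definition hcomp :: "nat \<Rightarrow> 'a::zero mpoly \<Rightarrow> 'a mpoly"
  is "\<lambda>d f m. if mdeg m = d then f m else 0"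
proof -
  fix d and f :: "(nat \<Rightarrow>\<^sub>0 nat) \<Rightarrow> 'a"
  assume "finite {x. f x \<noteq> 0}"
  then show "finite {m. (if mdeg m = d then f m else 0) \<noteq> 0}" by (rule rev_finite_subset) (auto split: if_splits)
qed

lemma keys_hcomp: "Poly_Mapping.keys (hcomp d f) = {m \<in> Poly_Mapping.keys f. mdeg m = d}"
  by (auto simp: in_keys_iff hcomp.rep_eq split: if_splits)

lemma hcomp_add: "hcomp d (f + g) = hcomp d f + hcomp d g"
  by (rule poly_mapping_eqI) (simp add: hcomp.rep_eq lookup_add)

lemma hcomp_diff: "hcomp d (f - g :: 'a::comm_ring_1 mpoly) = hcomp d f - hcomp d g"
  by (rule poly_mapping_eqI) (simp add: hcomp.rep_eq lookup_minus)

lemma hcomp_0 [simp]: "hcomp d 0 = 0"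
  by (rule poly_mapping_eqI) (simp add: hcomp.rep_eq)

lemma hcomp_sum: "hcomp d (sum f A) = (\<Sum>x\<in>A. hcomp d (f x))"
  by (induction A rule: infinite_finite_induct) (simp_all add: hcomp_add)

lemma homog_hcomp [simp]: "homog d (hcomp d f)"
  by (simp add: homog_def keys_hcomp)

lemma in_vars_hcomp [intro, simp]: "in_vars N f \<Longrightarrow> in_vars N (hcomp d f)"
  by (simp add: in_vars_def keys_hcomp)

lemma hcomp_homog: "homog d f \<Longrightarrow> hcomp d f = f"
  by (rule poly_mapping_eqI) (auto simp: hcomp.rep_eq homog_def in_keys_iff)

lemma hcomp_homog_other: "homog e f \<Longrightarrow> d \<noteq> e \<Longrightarrow> hcomp d f = 0"
  by (rule poly_mapping_eqI) (auto simp: hcomp.rep_eq homog_def in_keys_iff)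

text \<open>Multiplication by a form shifts the grading. Both sides are additive in
  \<open>f\<close>, so it suffices to treat a single term, which is homogeneous.\<close>

lemma hcomp_mult_homog:
  fixes f g :: "'a::comm_ring_1 mpoly"
  assumes g: "homog e g"
  shows "hcomp d (f * g) = (if e \<le> d then hcomp (d - e) f * g else 0)"
proof (induction f rule: mpoly_single_induct)
  case zero
  then show ?case by simp
next
  case (add m c f)
  have s: "homog (mdeg m) (Poly_Mapping.single m c)" by (simp add: homog_def)
  have m: "homog (mdeg m + e) (Poly_Mapping.single m c * g)" by (rule homog_mult[OF s g])
  have "hcomp d (Poly_Mapping.single m c * g)
      = (if e \<le> d then hcomp (d - e) (Poly_Mapping.single m c) * g else 0)"
    using hcomp_homog[OF m] hcomp_homog_other[OF m, of d] hcomp_homog[OF s]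
      hcomp_homog_other[OF s, of "d - e"]
    by (cases "d = mdeg m + e") auto
  then show ?case using add by (simp add: hcomp_add distrib_right)
qed

lemma linear_form_eq:
  fixes f :: "'a::comm_semiring_1 mpoly"
  assumes "in_vars N f" "homog 1 f"
  shows "f = (\<Sum>v<N. const (Poly_Mapping.lookup f (Poly_Mapping.single v 1)) * var v)"
proof (rule poly_mapping_eqI)
  fix m
  have eq: "(\<Sum>v<N. const (Poly_Mapping.lookup f (Poly_Mapping.single v 1)) * var v)
     = (\<Sum>v<N. Poly_Mapping.single (Poly_Mapping.single v 1) (Poly_Mapping.lookup f (Poly_Mapping.single v 1)))"
    by (simp add: const_def var_def mult_single)
  have "\<exists>v<N. m = Poly_Mapping.single v 1" if "m \<in> Poly_Mapping.keys f"
  proof -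
    have d: "(\<Sum>v\<in>Poly_Mapping.keys m. Poly_Mapping.lookup m v) = 1"
      using assms(2) that by (auto simp: homog_def mdeg_def)
    then obtain v where v: "v \<in> Poly_Mapping.keys m" "Poly_Mapping.lookup m v = 1"
        "\<forall>w\<in>Poly_Mapping.keys m. v \<noteq> w \<longrightarrow> Poly_Mapping.lookup m w = 0"
      using sum_eq_1_iff[of "Poly_Mapping.keys m" "Poly_Mapping.lookup m"] by auto
    have "m = Poly_Mapping.single v 1"
      using v by (intro poly_mapping_eqI) (auto simp: lookup_single when_def in_keys_iff)
    moreover have "v < N" using v(1) assms(1) that by (auto simp: in_vars_def)
    ultimately show ?thesis by blast
  qed
  moreover have "m \<notin> Poly_Mapping.keys f \<Longrightarrow> Poly_Mapping.lookup f m = 0" by (simp add: in_keys_iff)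
  moreover have "Poly_Mapping.single v (1::nat) = Poly_Mapping.single w 1 \<longleftrightarrow> v = w" for v w :: nat
    by (metis lookup_single_eq lookup_single_not_eq zero_neq_one)
  ultimately show "Poly_Mapping.lookup f m = Poly_Mapping.lookup
     (\<Sum>v<N. const (Poly_Mapping.lookup f (Poly_Mapping.single v 1)) * var v) m"
    unfolding eq lookup_sum lookup_single when_def
    by (cases "m \<in> Poly_Mapping.keys f") (auto intro!: sum.neutral split: if_splits)
qed

subsection \<open>Ideals\<close>

context
  fixes N :: nat and q :: "nat \<Rightarrow> 'a::comm_ring_1 mpoly"
begin

lemma gen_ideal_0 [simp]: "gen_ideal N q 0 = {0}"
  by (auto simp: gen_ideal_def)

lemma gen_idealD:
  assumes "f \<in> gen_ideal N q j"
  shows "\<exists>a. f = (\<Sum>i<j. a i * q i) \<and> (\<forall>i. in_vars N (a i))"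
proof -
  from assms obtain a where a: "f = (\<Sum>i<j. a i * q i)" "\<forall>i<j. in_vars N (a i)"
    by (auto simp: gen_ideal_def)
  \<comment> \<open>Coefficients beyond \<open>j\<close> are reset to 0, so that the variable
    condition holds at every index.\<close>
  show ?thesis
    by (rule exI[of _ "\<lambda>i. if i < j then a i else 0"]) (use a in auto)
qed

lemma gen_idealI: "(\<And>i. i < j \<Longrightarrow> in_vars N (a i)) \<Longrightarrow> (\<Sum>i<j. a i * q i) \<in> gen_ideal N q j"
  by (auto simp: gen_ideal_def)

text \<open>The coefficient of the last generator is split off; inductions on the number of
  generators, also those in the Koszul arguments, run through this form.\<close>

lemma gen_ideal_Suc_iff:
  "f \<in> gen_ideal N q (Suc j) \<longleftrightarrow> (\<exists>g. in_vars N g \<and> f - g * q j \<in> gen_ideal N q j)"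
proof
  assume "f \<in> gen_ideal N q (Suc j)"
  then obtain a where a: "f = (\<Sum>i<Suc j. a i * q i)" "\<forall>i. in_vars N (a i)"
    by (blast dest: gen_idealD)
  then have "f - a j * q j \<in> gen_ideal N q j" by (auto intro: gen_idealI)
  with a show "\<exists>g. in_vars N g \<and> f - g * q j \<in> gen_ideal N q j" by blast
next
  assume "\<exists>g. in_vars N g \<and> f - g * q j \<in> gen_ideal N q j"
  then obtain g a where g: "in_vars N g" "f - g * q j = (\<Sum>i<j. a i * q i)" "\<forall>i. in_vars N (a i)"
    by (blast dest: gen_idealD)
  have "f = (\<Sum>i<Suc j. (a(j := g)) i * q i)"
    using g(2) by (simp add: algebra_simps)
  also have "\<dots> \<in> gen_ideal N q (Suc j)" by (rule gen_idealI) (use g in auto)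
  finally show "f \<in> gen_ideal N q (Suc j)" .
qed

lemma gen_ideal_zero [simp]: "0 \<in> gen_ideal N q j"
  using gen_idealI[of j "\<lambda>_. 0"] by simp

lemma gen_ideal_add [intro]:
  "f \<in> gen_ideal N q j \<Longrightarrow> g \<in> gen_ideal N q j \<Longrightarrow> f + g \<in> gen_ideal N q j"
  by (drule gen_idealD)+ (auto simp flip: sum.distrib distrib_right intro!: gen_idealI)

lemma gen_ideal_mult_left [intro]:
  "f \<in> gen_ideal N q j \<Longrightarrow> in_vars N c \<Longrightarrow> c * f \<in> gen_ideal N q j"
  by (drule gen_idealD)+ (auto simp: sum_distrib_left simp flip: mult.assoc intro!: gen_idealI)

lemma gen_ideal_mult_right [intro]:
  "f \<in> gen_ideal N q j \<Longrightarrow> in_vars N c \<Longrightarrow> f * c \<in> gen_ideal N q j"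
  by (metis gen_ideal_mult_left mult.commute)

lemma gen_ideal_uminus: "f \<in> gen_ideal N q j \<Longrightarrow> - f \<in> gen_ideal N q j"
  using gen_ideal_mult_left[of f j "-1"] by simp

lemma gen_ideal_diff [intro]:
  "f \<in> gen_ideal N q j \<Longrightarrow> g \<in> gen_ideal N q j \<Longrightarrow> f - g \<in> gen_ideal N q j"
  using gen_ideal_add[of f j "- g"] gen_ideal_uminus[of g] by simp

lemma gen_ideal_sum [intro]:
  "(\<And>x. x \<in> X \<Longrightarrow> f x \<in> gen_ideal N q j) \<Longrightarrow> sum f X \<in> gen_ideal N q j"
  by (induction X rule: infinite_finite_induct) auto

lemma gen_ideal_Suc: "f \<in> gen_ideal N q j \<Longrightarrow> f \<in> gen_ideal N q (Suc j)"
  unfolding gen_ideal_Suc_iff by (rule exI[of _ 0]) simp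

lemma gen_ideal_mono: "i \<le> j \<Longrightarrow> f \<in> gen_ideal N q i \<Longrightarrow> f \<in> gen_ideal N q j"
  by (induction j rule: dec_induct) (auto intro: gen_ideal_Suc)

lemma gen_ideal_generator: "i < j \<Longrightarrow> q i \<in> gen_ideal N q j"
  by (rule gen_ideal_mono[of "Suc i"]) (auto simp: gen_ideal_Suc_iff intro!: exI[of _ 1])

text \<open>Taking components of the coefficients shows that forms of one degree generate a
  homogeneous ideal. This is what allows witnesses to be cut down to a fixed degree.\<close>

lemma gen_ideal_hcomp:
  assumes "f \<in> gen_ideal N q j" "\<And>i. i < j \<Longrightarrow> homog e (q i)"
  shows "hcomp d f \<in> gen_ideal N q j"
proof -
  from assms(1) obtain a where a: "f = (\<Sum>i<j. a i * q i)" "\<forall>i. in_vars N (a i)"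
    by (blast dest: gen_idealD)
  have "hcomp d f = (\<Sum>i<j. (if e \<le> d then hcomp (d - e) (a i) else 0) * q i)"
    unfolding a(1) hcomp_sum by (intro sum.cong) (auto simp: hcomp_mult_homog[OF assms(2)])
  then show ?thesis using a(2) by (auto intro!: gen_idealI)
qed

lemma gen_ideal_hcomp_less:
  assumes "f \<in> gen_ideal N q j" "\<And>i. i < j \<Longrightarrow> homog e (q i)" "d < e"
  shows "hcomp d f = 0"
proof -
  from assms(1) obtain a where a: "f = (\<Sum>i<j. a i * q i)"
    by (blast dest: gen_idealD)
  have "hcomp d (a i * q i) = 0" if "i < j" for i
    using hcomp_mult_homog[OF assms(2)[OF that], of d "a i"] assms(3) by simp
  then show ?thesis by (simp add: a hcomp_sum)
qed

end

subsection \<open>The Koszul complex\<close>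

text \<open>A chain of degree p is a function on the p-element subsets of the index set; its values on
other sets are irrelevant.\<close>

definition ksgn :: "nat \<Rightarrow> nat set \<Rightarrow> 'b::comm_ring_1" where
  "ksgn i B = (- 1) ^ card {a \<in> B. a < i}"

text \<open>Contraction with \<open>q\<close>, the Koszul differential, on coefficients:
  \<open>\<omega> B\<close> is the coefficient of the exterior basis element of \<open>B\<close>,
  and the new coefficient at \<open>B\<close> collects the terms that lose one index.\<close>

definition kd :: "(nat \<Rightarrow> 'b) \<Rightarrow> nat \<Rightarrow> (nat set \<Rightarrow> 'b) \<Rightarrow> nat set \<Rightarrow> 'b::comm_ring_1" where
  "kd q r \<omega> B = (\<Sum>i\<in>{..<r} - B. ksgn i B * q i * \<omega> (insert i B))"

text \<open>Exterior multiplication by the vector \<open>v\<close> from the left, in the same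
  coordinates.\<close>

definition kwedge :: "(nat \<Rightarrow> 'b) \<Rightarrow> (nat set \<Rightarrow> 'b) \<Rightarrow> nat set \<Rightarrow> 'b::comm_ring_1" where
  "kwedge v \<omega> B = (\<Sum>i\<in>B. ksgn i (B - {i}) * v i * \<omega> (B - {i}))"

lemma ksgn_cases: "(ksgn i B :: 'b::comm_ring_1) = 1 \<or> (ksgn i B :: 'b) = - 1"
  by (cases "even (card {a \<in> B. a < i})") (simp_all add: ksgn_def)

lemma ksgn_square [simp]: "ksgn i B * ksgn i B = (1 :: 'b::comm_ring_1)"
  using ksgn_cases[of i B, where 'b='b] by auto

lemma ksgn_square_mult [simp]: "ksgn i B * (ksgn i B * x) = x"
  by (simp flip: mult.assoc)

lemma in_vars_ksgn [simp]: "in_vars N (ksgn i B :: 'a::comm_ring_1 mpoly)"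
  using ksgn_cases[of i B, where 'b="'a mpoly"] by auto

lemma ksgn_insert_less: "finite B \<Longrightarrow> j \<notin> B \<Longrightarrow> j < i \<Longrightarrow> ksgn i (insert j B) = - ksgn i B"
proof -
  assume *: "finite B" "j \<notin> B" "j < i"
  have "{a \<in> insert j B. a < i} = insert j {a \<in> B. a < i}" using * by auto
  then show ?thesis using * by (simp add: ksgn_def)
qed

lemma ksgn_insert_greater: "i \<le> j \<Longrightarrow> ksgn i (insert j B) = ksgn i B"
  unfolding ksgn_def by (rule arg_cong[where f="\<lambda>X. (-1) ^ card X"]) auto

lemma ksgn_anticommute:
  assumes "finite B" "i \<notin> B" "j \<notin> B" "i \<noteq> j"
  shows "ksgn i B * ksgn j (insert i B) = - (ksgn j B * ksgn i (insert j B))"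
  using assms by (cases "i < j") (simp_all add: ksgn_insert_less ksgn_insert_greater)

lemma ksgn_anticommute':
  assumes "finite B" "i \<notin> B" "j \<notin> B" "i \<noteq> j"
  shows "ksgn j (insert i B) * ksgn i (insert j B) = - (ksgn i B * ksgn j B)"
  using assms by (cases "i < j") (simp_all add: ksgn_insert_less ksgn_insert_greater)

lemma kd_cong: "(\<And>i. i < r \<Longrightarrow> i \<notin> B \<Longrightarrow> \<omega> (insert i B) = \<eta> (insert i B)) \<Longrightarrow> kd q r \<omega> B = kd q r \<eta> B"
  by (auto simp: kd_def intro!: sum.cong)

lemma kd_zero [simp]: "kd q r (\<lambda>_. 0) B = 0"
  by (simp add: kd_def)

lemma kd_add: "kd q r (\<lambda>B. \<omega> B + \<eta> B) B = kd q r \<omega> B + kd q r \<eta> B"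
  by (simp add: kd_def distrib_left sum.distrib)

lemma kd_diff: "kd q r (\<lambda>B. \<omega> B - \<eta> B) B = kd q r \<omega> B - kd q r \<eta> B"
  by (simp add: kd_def right_diff_distrib sum_subtractf)

lemma kd_scale: "kd q r (\<lambda>B. c * \<omega> B) B = c * kd q r \<omega> B"
  by (simp add: kd_def sum_distrib_left ac_simps)

lemma kd_in_vars:
  "(\<And>B. in_vars N (\<omega> B)) \<Longrightarrow> (\<And>i. i < r \<Longrightarrow> in_vars N (q i)) \<Longrightarrow> in_vars N (kd q r \<omega> B)"
  unfolding kd_def by (intro in_vars_sum in_vars_mult) auto

text \<open>The terms at \<open>(i, j)\<close> and \<open>(j, i)\<close> cancel. Peeling off one
  element at a time pairs them without dividing by 2.\<close>

lemma sum_antisym_eq_0: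
  fixes h :: "'c \<Rightarrow> 'c \<Rightarrow> 'b::ab_group_add"
  assumes "finite X" "\<And>i j. i \<in> X \<Longrightarrow> j \<in> X \<Longrightarrow> i \<noteq> j \<Longrightarrow> h i j = - h j i"
  shows "(\<Sum>i\<in>X. \<Sum>j\<in>X - {i}. h i j) = 0"
  using assms
proof (induction X rule: finite_induct)
  case (insert x F)
  have IH: "(\<Sum>i\<in>F. \<Sum>j\<in>F - {i}. h i j) = 0" by (rule insert.IH) (rule insert.prems, auto)
  have "(\<Sum>i\<in>F. \<Sum>j\<in>insert x F - {i}. h i j) = (\<Sum>i\<in>F. h i x + (\<Sum>j\<in>F - {i}. h i j))"
  proof (rule sum.cong[OF refl])
    fix i assume "i \<in> F"
    then have "insert x F - {i} = insert x (F - {i})" using insert.hyps by auto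
    then show "(\<Sum>j\<in>insert x F - {i}. h i j) = h i x + (\<Sum>j\<in>F - {i}. h i j)"
      using insert.hyps by simp
  qed
  also have "\<dots> = (\<Sum>i\<in>F. h i x)" using IH by (simp add: sum.distrib)
  also have "\<dots> = (\<Sum>i\<in>F. - h x i)"
    by (intro sum.cong refl insert.prems) (use insert.hyps in auto)
  finally show ?case using insert.hyps by (simp add: sum_negf)
qed simp

lemma kd_kd:
  fixes q :: "nat \<Rightarrow> 'b::comm_ring_1"
  assumes "finite B"
  shows "kd q r (kd q r \<omega>) B = 0"
proof -
  let ?X = "{..<r} - B"
  have "kd q r (kd q r \<omega>) B = (\<Sum>i\<in>?X. \<Sum>j\<in>?X - {i}.
      ksgn i B * ksgn j (insert i B) * (q i * q j * \<omega> (insert i (insert j B))))"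
    unfolding kd_def sum_distrib_left
    by (intro sum.cong) (auto simp: ac_simps insert_commute)
  also have "\<dots> = 0"
  proof (rule sum_antisym_eq_0)
    fix i j assume "i \<in> ?X" "j \<in> ?X" "i \<noteq> j"
    then have "ksgn i B * ksgn j (insert i B) = - (ksgn j B * ksgn i (insert j B) :: 'b)" (is "?l = - ?r")
      using assms by (intro ksgn_anticommute) auto
    then have "?l * (q i * q j * \<omega> (insert i (insert j B))) = - ?r * (q i * q j * \<omega> (insert i (insert j B)))"
      by simp
    then show "?l * (q i * q j * \<omega> (insert i (insert j B))) = - (?r * (q j * q i * \<omega> (insert j (insert i B))))"
      by (simp add: insert_commute ac_simps)
  qed simp
  finally show ?thesis .
qed

text \<open>Contraction is an antiderivation. Hence wedging with the coefficients of a relation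
  among the \<open>q i\<close> sends cycles to cycles of one degree more.\<close>

lemma kd_kwedge:
  assumes "B \<subseteq> {..<r}"
  shows "kd q r (kwedge v \<omega>) B = (\<Sum>i<r. v i * q i) * \<omega> B - kwedge v (kd q r \<omega>) B"
proof -
  let ?X = "{..<r} - B"
  have fin: "finite B" using assms finite_subset by blast
  \<comment> \<open>\<open>T i j\<close> is the term in which \<open>i\<close> leaves
    \<open>B\<close> and \<open>j\<close> enters. It occurs with opposite signs in the two
    compositions, so only the diagonal terms \<open>v i * q i\<close> survive.\<close>
  define T where "T = (\<lambda>i j. ksgn i (B - {i}) * ksgn j (B - {i}) * (v i * q j * \<omega> (insert j (B - {i}))))"
  have 1: "ksgn j B * q j * kwedge v \<omega> (insert j B) = v j * q j * \<omega> B - (\<Sum>i\<in>B. T i j)"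
    if j: "j \<in> ?X" for j
  proof -
    have e: "insert j B - {i} = insert j (B - {i})" if "i \<in> B" for i using that j by auto
    have s: "ksgn j B * ksgn i (insert j (B - {i})) = - (ksgn i (B - {i}) * ksgn j (B - {i}))" (is "?l = ?r")
      if "i \<in> B" for i
      using ksgn_anticommute'[of "B - {i}" i j] that j fin by (auto simp: insert_absorb)
    have s': "ksgn j B * q j * (ksgn i (insert j (B - {i})) * v i * \<omega> (insert j (B - {i}))) = - T i j"
      if "i \<in> B" for i
      using arg_cong[OF s[OF that], of "\<lambda>t. t * (v i * q j * \<omega> (insert j (B - {i})))"]
      by (simp add: T_def ac_simps)
    have "kwedge v \<omega> (insert j B) = ksgn j B * v j * \<omega> B
        + (\<Sum>i\<in>B. ksgn i (insert j (B - {i})) * v i * \<omega> (insert j (B - {i})))"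
      using j fin by (simp add: kwedge_def e)
    then have "ksgn j B * q j * kwedge v \<omega> (insert j B) = ksgn j B * q j * (ksgn j B * v j * \<omega> B)
        + (\<Sum>i\<in>B. ksgn j B * q j * (ksgn i (insert j (B - {i})) * v i * \<omega> (insert j (B - {i}))))"
      by (simp only: distrib_left sum_distrib_left)
    also have "(\<Sum>i\<in>B. ksgn j B * q j * (ksgn i (insert j (B - {i})) * v i * \<omega> (insert j (B - {i}))))
        = - (\<Sum>i\<in>B. T i j)"
      by (simp only: s' sum_negf cong: sum.cong)
    finally show ?thesis by (simp add: ac_simps)
  qed
  have 2: "ksgn i (B - {i}) * v i * kd q r \<omega> (B - {i}) = v i * q i * \<omega> B + (\<Sum>j\<in>?X. T i j)"
    if i: "i \<in> B" for i
  proof -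
    have "{..<r} - (B - {i}) = insert i ?X" using i assms by auto
    then have "kd q r \<omega> (B - {i}) = ksgn i (B - {i}) * q i * \<omega> B
        + (\<Sum>j\<in>?X. ksgn j (B - {i}) * q j * \<omega> (insert j (B - {i})))"
      using i by (simp add: kd_def insert_absorb)
    then show ?thesis
      by (simp add: distrib_left sum_distrib_left T_def ac_simps)
  qed
  have "kd q r (kwedge v \<omega>) B = (\<Sum>j\<in>?X. v j * q j * \<omega> B) - (\<Sum>j\<in>?X. \<Sum>i\<in>B. T i j)"
    unfolding kd_def by (simp add: 1 sum_subtractf)
  moreover have "kwedge v (kd q r \<omega>) B = (\<Sum>i\<in>B. v i * q i * \<omega> B) + (\<Sum>i\<in>B. \<Sum>j\<in>?X. T i j)"
    unfolding kwedge_def by (simp add: 2 sum.distrib)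
  moreover have "(\<Sum>i<r. v i * q i * \<omega> B) = (\<Sum>i\<in>B. v i * q i * \<omega> B) + (\<Sum>j\<in>?X. v j * q j * \<omega> B)"
    using sum.subset_diff[OF assms, of "\<lambda>i. v i * q i * \<omega> B"] by simp
  ultimately show ?thesis
    using sum.swap[of T ?X B] by (simp add: sum_distrib_right)
qed

text \<open>Cycles over the quotient by \<open>A\<close>, tested on representatives. With
  \<open>Suc (card B) = p\<close>, no condition is imposed for \<open>p = 0\<close>: every chain of
  degree 0 is a cycle.\<close>

definition kcyc :: "'b set \<Rightarrow> (nat \<Rightarrow> 'b) \<Rightarrow> nat \<Rightarrow> nat \<Rightarrow> (nat set \<Rightarrow> 'b::comm_ring_1) \<Rightarrow> bool" where
  "kcyc A q r p \<omega> \<longleftrightarrow> (\<forall>B\<subseteq>{..<r}. Suc (card B) = p \<longrightarrow> kd q r \<omega> B \<in> A)"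

definition kbnd :: "nat \<Rightarrow> 'a mpoly set \<Rightarrow> (nat \<Rightarrow> 'a mpoly) \<Rightarrow> nat \<Rightarrow> nat \<Rightarrow> (nat set \<Rightarrow> 'a::comm_ring_1 mpoly) \<Rightarrow> bool"
  where "kbnd N A q r p \<omega> \<longleftrightarrow> (\<exists>\<eta>. (\<forall>B. in_vars N (\<eta> B)) \<and>
    (\<forall>B\<subseteq>{..<r}. card B = p \<longrightarrow> \<omega> B - kd q r \<eta> B \<in> A))"

lemma kbndI:
  assumes "\<And>B. in_vars N (\<eta> B)" "\<And>B. B \<subseteq> {..<r} \<Longrightarrow> card B = p \<Longrightarrow> \<omega> B - kd q r \<eta> B \<in> A"
  shows "kbnd N A q r p \<omega>"
  unfolding kbnd_def by (rule exI[of _ \<eta>]) (simp add: assms)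

text \<open>Splitting sets by whether they contain \<open>r\<close> presents the complex on
  \<open>Suc r\<close> elements as the mapping cone of multiplication by \<open>q r\<close>.\<close>

lemma kd_Suc:
  assumes "B \<subseteq> {..<r}"
  shows "kd q (Suc r) \<omega> B = kd q r \<omega> B + ksgn r B * q r * \<omega> (insert r B)"
proof -
  have "{..<Suc r} - B = insert r ({..<r} - B)" using assms by auto
  then show ?thesis by (simp add: kd_def)
qed

lemma kd_Suc_insert:
  assumes "B \<subseteq> {..<r}"
  shows "kd q (Suc r) \<omega> (insert r B) = kd q r (\<lambda>B. \<omega> (insert r B)) B"
proof -
  have "{..<Suc r} - insert r B = {..<r} - B" by auto
  then show ?thesis by (auto simp: kd_def ksgn_insert_greater insert_commute intro!: sum.cong)
qed

lemma subset_lessThan_Suc_cases: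
  assumes "B \<subseteq> {..<Suc r}"
  obtains "B \<subseteq> {..<r}" | C where "B = insert r C" "C \<subseteq> {..<r}" "card B = Suc (card C)"
proof (cases "r \<in> B")
  case True
  have s: "B - {r} \<subseteq> {..<r}" using assms by auto
  then have "finite (B - {r})" by (rule finite_subset) simp
  then have "card B = Suc (card (B - {r}))" using True by (metis card.insert_remove finite_Diff_insert finite_insert insert_Diff_single insert_absorb)
  with True s show thesis by (intro that(2)[of "B - {r}"]) auto
next
  case False
  with assms show thesis by (intro that(1)) (auto simp: lessThan_Suc)
qed

lemma kbnd_0_iff:
  assumes "\<And>i. i < r \<Longrightarrow> in_vars N (q i)"
  shows "kbnd N {0} q r 0 \<omega> \<longleftrightarrow> \<omega> {} \<in> gen_ideal N q r"
proof
  assume "kbnd N {0} q r 0 \<omega>"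
  then obtain \<eta> where "\<forall>B. in_vars N (\<eta> B)" "\<omega> {} = kd q r \<eta> {}"
    by (auto simp: kbnd_def)
  moreover have "kd q r \<eta> {} = (\<Sum>i<r. \<eta> {i} * q i)"
    by (simp add: kd_def ksgn_def mult.commute)
  ultimately show "\<omega> {} \<in> gen_ideal N q r" by (auto intro: gen_idealI)
next
  assume "\<omega> {} \<in> gen_ideal N q r"
  then obtain a where a: "\<omega> {} = (\<Sum>i<r. a i * q i)" "\<forall>i. in_vars N (a i)"
    using gen_idealD by blast
  define \<gamma> where "\<gamma> = (\<lambda>B. \<Sum>i<r. if B = {i} then a i else 0)"
  have "in_vars N (\<gamma> B)" for B using a(2) by (auto simp: \<gamma>_def intro!: in_vars_sum)
  moreover have "\<omega> {} = kd q r \<gamma> {}"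
    by (simp add: a kd_def \<gamma>_def ksgn_def mult.commute)
  moreover have "B = {}" if "B \<subseteq> {..<r}" "card B = 0" for B
    using that finite_subset[OF that(1)] by simp
  ultimately show "kbnd N {0} q r 0 \<omega>" by (intro kbndI[of N \<gamma>]) auto
qed

text \<open>Induction through the mapping cone: the part of a cycle on sets containing the last
  index is bounded first, and the remainder is a cycle for the shorter regular sequence.\<close>

lemma koszul_acyclic:
  fixes q :: "nat \<Rightarrow> 'a::comm_ring_1 mpoly"
  assumes "\<And>j. j < r \<Longrightarrow> in_vars N (q j)"
    and "\<And>j f. j < r \<Longrightarrow> in_vars N f \<Longrightarrow> f * q j \<in> gen_ideal N q j \<Longrightarrow> f \<in> gen_ideal N q j"
    and "\<And>B. in_vars N (\<omega> B)" "kcyc {0} q r p \<omega>" "p \<ge> 1"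
  shows "kbnd N {0} q r p \<omega>"
  using assms
proof (induction r arbitrary: \<omega> p)
  case 0
  then show ?case by (auto simp: kbnd_def)
next
  case (Suc r)
  obtain p' where p: "p = Suc p'" using Suc.prems(5) by (cases p) auto
  have cyc: "kd q (Suc r) \<omega> B = 0" if "B \<subseteq> {..<Suc r}" "card B = p'" for B
    using Suc.prems(4) that p by (auto simp: kcyc_def)
  have fin: "finite B" if "B \<subseteq> {..<r}" for B using that finite_subset by blast
  have sub: "B \<subseteq> {..<Suc r}" "insert r B \<subseteq> {..<Suc r}" "r \<notin> B" if "B \<subseteq> {..<r}" for B
    using that by auto
  have IH: "kbnd N {0} q r p \<omega>" if "\<And>B. in_vars N (\<omega> B)" "kcyc {0} q r p \<omega>" "p \<ge> 1" for \<omega> p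
    by (rule Suc.IH[OF Suc.prems(1,2) that]) simp_all
  define \<beta> where "\<beta> = (\<lambda>B. \<omega> (insert r B))"
  have "kbnd N {0} q r p' \<beta>"
  \<comment> \<open>In degree 0 the cycle condition puts \<open>\<omega> {r} * q r\<close> into the
    ideal of the earlier generators, which is where regularity enters. In higher degree
    \<open>\<beta>\<close> is itself a cycle for the first \<open>r\<close> elements.\<close>
  proof (cases p')
    case 0
    have "kd q r \<omega> {} + q r * \<omega> {r} = 0"
      using cyc[of "{}"] 0 by (simp add: kd_Suc ksgn_def)
    then have "\<omega> {r} * q r = - kd q r \<omega> {}" by (simp add: mult.commute eq_neg_iff_add_eq_0 add.commute)
    also have "\<dots> = (\<Sum>i<r. (- \<omega> {i}) * q i)"
      by (simp add: kd_def ksgn_def sum_negf mult.commute)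
    also have "\<dots> \<in> gen_ideal N q r" by (rule gen_idealI) (use Suc.prems(3) in auto)
    finally have "\<omega> {r} * q r \<in> gen_ideal N q r" .
    from Suc.prems(2)[OF _ Suc.prems(3) this] have "\<omega> {r} \<in> gen_ideal N q r" by simp
    then show ?thesis using kbnd_0_iff[of r N q \<beta>] Suc.prems(1) by (simp add: 0 \<beta>_def)
  next
    case (Suc p'')
    have "kd q r \<beta> B = 0" if B: "B \<subseteq> {..<r}" "Suc (card B) = p'" for B
      using cyc[of "insert r B"] B sub[OF B(1)] fin[OF B(1)] kd_Suc_insert[OF B(1), of q \<omega>]
      by (simp add: \<beta>_def)
    then show ?thesis using Suc.prems(3) Suc by (intro IH) (auto simp: kcyc_def \<beta>_def)
  qed
  then obtain \<gamma> where \<gamma>: "\<forall>B. in_vars N (\<gamma> B)" "\<And>B. B \<subseteq> {..<r} \<Longrightarrow> card B = p' \<Longrightarrow> \<beta> B = kd q r \<gamma> B"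
    unfolding kbnd_def by auto
  \<comment> \<open>Placing \<open>\<gamma>\<close> on the sets containing \<open>r\<close> makes
    \<open>\<omega>'\<close> vanish on all sets of size \<open>p\<close> that contain
    \<open>r\<close>.\<close>
  define \<delta> where "\<delta> = (\<lambda>B. if r \<in> B then \<gamma> (B - {r}) else 0)"
  define \<omega>' where "\<omega>' = (\<lambda>B. \<omega> B - kd q (Suc r) \<delta> B)"
  have \<delta>v: "in_vars N (\<delta> B)" for B using \<gamma> by (simp add: \<delta>_def)
  have \<omega>'v: "in_vars N (\<omega>' B)" for B
    using Suc.prems(1,3) \<delta>v by (auto simp: \<omega>'_def intro!: kd_in_vars)
  have \<delta>_ins: "kd q (Suc r) \<delta> (insert r B) = kd q r \<gamma> B" if "B \<subseteq> {..<r}" for B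
    unfolding kd_Suc_insert[OF that] using that by (intro kd_cong) (auto simp: \<delta>_def intro!: arg_cong[where f=\<gamma>])
  have \<omega>'_ins: "\<omega>' (insert r B) = 0" if "B \<subseteq> {..<r}" "card B = p'" for B
    using \<gamma>(2)[OF that] \<delta>_ins[OF that(1)] by (simp add: \<omega>'_def \<beta>_def)
  have "kd q r \<omega>' B = 0" if B: "B \<subseteq> {..<r}" "card B = p'" for B
  proof -
    have "kd q (Suc r) \<omega>' B = 0"
      using cyc[OF sub(1)[OF B(1)] B(2)] kd_kd[OF fin[OF B(1)], of q "Suc r" \<delta>]
      by (simp add: \<omega>'_def kd_diff)
    then show ?thesis using \<omega>'_ins[OF B] by (simp add: kd_Suc[OF B(1)])
  qed
  then have "kbnd N {0} q r p \<omega>'"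
    using \<omega>'v Suc.prems(5) by (intro IH) (auto simp: kcyc_def p)
  then obtain \<xi> where \<xi>: "\<forall>B. in_vars N (\<xi> B)" "\<And>B. B \<subseteq> {..<r} \<Longrightarrow> card B = p \<Longrightarrow> \<omega>' B = kd q r \<xi> B"
    unfolding kbnd_def by auto
  define \<xi>' where "\<xi>' = (\<lambda>B. if r \<in> B then 0 else \<xi> B)"
  have "\<omega>' B = kd q (Suc r) \<xi>' B" if "B \<subseteq> {..<Suc r}" "card B = p" for B
    using that(1)
  proof (cases rule: subset_lessThan_Suc_cases)
    case 1
    have "kd q (Suc r) \<xi>' B = kd q r \<xi>' B" by (simp add: kd_Suc[OF 1] \<xi>'_def)
    also have "\<dots> = kd q r \<xi> B" using 1 by (intro kd_cong) (auto simp: \<xi>'_def)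
    finally show ?thesis using \<xi>(2)[OF 1 that(2)] by simp
  next
    case (2 C)
    then have "kd q (Suc r) \<xi>' B = kd q r (\<lambda>_. 0) C"
      using kd_Suc_insert[OF 2(2), of q \<xi>'] by (simp add: \<xi>'_def)
    then show ?thesis using \<omega>'_ins[OF 2(2)] that p 2 by simp
  qed
  note \<omega>'_eq = this
  have "\<omega> B - kd q (Suc r) (\<lambda>B. \<delta> B + \<xi>' B) B = 0" if "B \<subseteq> {..<Suc r}" "card B = p" for B
    using \<omega>'_eq[OF that] unfolding kd_add by (simp add: \<omega>'_def algebra_simps)
  moreover have "in_vars N (\<delta> B + \<xi>' B)" for B using \<delta>v \<xi>(1) by (auto simp: \<xi>'_def)
  ultimately show ?case unfolding kbnd_def by (intro exI[of _ "\<lambda>B. \<delta> B + \<xi>' B"]) auto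
qed

text \<open>The value 0 is chosen where \<open>C\<close> fails, so that the chain has values in the
  right variables everywhere.\<close>

lemma chain_choice:
  assumes "\<And>B. C B \<Longrightarrow> \<exists>g. in_vars N g \<and> R B (g :: 'a::zero mpoly)"
  shows "\<exists>\<zeta>. (\<forall>B. in_vars N (\<zeta> B)) \<and> (\<forall>B. C B \<longrightarrow> R B (\<zeta> B))"
proof -
  have "\<forall>B. \<exists>g. in_vars N g \<and> (C B \<longrightarrow> R B g)" using assms in_vars_0 by metis
  from choice[OF this] show ?thesis by blast
qed

section \<open>Koszul homology of the quadrics modulo linear forms\<close>

locale quadrics_and_linear_forms =
  fixes N R k :: nat and q b :: "nat \<Rightarrow> 'a::field mpoly"
  assumes q_vars: "i < R \<Longrightarrow> in_vars N (q i)"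
    and q_homog: "i < R \<Longrightarrow> homog 2 (q i)"
    and q_regular: "j < R \<Longrightarrow> in_vars N f \<Longrightarrow> f * q j \<in> gen_ideal N q j \<Longrightarrow> f \<in> gen_ideal N q j"
    and b_vars: "i < k \<Longrightarrow> in_vars N (b i)"
    and b_homog: "i < k \<Longrightarrow> homog 1 (b i)"
    and b_regular: "j < k \<Longrightarrow> in_vars N f \<Longrightarrow> f * b j \<in> gen_ideal N b j \<Longrightarrow> f \<in> gen_ideal N b j"
begin

abbreviation A :: "nat \<Rightarrow> 'a mpoly set" where "A j \<equiv> gen_ideal N b j"

abbreviation d :: "(nat set \<Rightarrow> 'a mpoly) \<Rightarrow> nat set \<Rightarrow> 'a mpoly" where "d \<equiv> kd q R"

lemma d_vars: "(\<And>B. in_vars N (\<omega> B)) \<Longrightarrow> in_vars N (d \<omega> B)"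
  by (rule kd_in_vars) (auto intro: q_vars)

lemma finite_index: "B \<subseteq> {..<R} \<Longrightarrow> finite B"
  by (rule finite_subset) auto

lemma d_in_A:
  assumes "B \<subseteq> {..<R}" "\<And>C. C \<subseteq> {..<R} \<Longrightarrow> card C = Suc (card B) \<Longrightarrow> \<omega> C \<in> A j"
  shows "d \<omega> B \<in> A j"
  unfolding kd_def
proof (intro gen_ideal_sum gen_ideal_mult_left)
  fix i assume "i \<in> {..<R} - B"
  then show "\<omega> (insert i B) \<in> A j" using assms finite_index[OF assms(1)] by (intro assms(2)) auto
qed (auto intro: q_vars)

lemma hcomp_d: "hcomp e (d \<omega> B) = (if 2 \<le> e then d (\<lambda>B. hcomp (e - 2) (\<omega> B)) B else 0)"
proof -
  have "homog 2 (ksgn i B * q i)" if "i < R" for i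
    using ksgn_cases[of i B, where 'b="'a mpoly"] q_homog[OF that] by auto
  then have "hcomp e (\<omega> (insert i B) * (ksgn i B * q i))
      = (if 2 \<le> e then hcomp (e - 2) (\<omega> (insert i B)) * (ksgn i B * q i) else 0)" if "i < R" for i
    using that by (intro hcomp_mult_homog) simp
  then show ?thesis
    by (auto simp: kd_def hcomp_sum mult.commute intro!: sum.cong)
qed

lemma A_mult_b_cancel: "j < k \<Longrightarrow> in_vars N f \<Longrightarrow> b j * f \<in> A j \<Longrightarrow> f \<in> A j"
  using b_regular[of j f] by (simp add: mult.commute)

lemma b_mult_in_A_Suc: "j < k \<Longrightarrow> in_vars N f \<Longrightarrow> b j * f \<in> A (Suc j)"
  by (intro gen_ideal_mult_right gen_ideal_generator) auto

lemma A_Suc_chain: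
  assumes "\<forall>B. B \<subseteq> {..<R} \<longrightarrow> card B = p \<longrightarrow> \<omega> B \<in> A (Suc j)"
  shows "\<exists>\<zeta>. (\<forall>B. in_vars N (\<zeta> B)) \<and>
    (\<forall>B. B \<subseteq> {..<R} \<and> card B = p \<longrightarrow> \<omega> B - b j * \<zeta> B \<in> A j)"
proof (rule chain_choice)
  fix B assume "B \<subseteq> {..<R} \<and> card B = p"
  then show "\<exists>g. in_vars N g \<and> \<omega> B - b j * g \<in> A j"
    using assms by (simp add: gen_ideal_Suc_iff mult.commute)
qed

text \<open>Multiplication by \<open>b j\<close> on the quotient by \<open>A j\<close> gives a long
  exact sequence that places the homology over \<open>A (Suc j)\<close> in degree \<open>p\<close>
  between the homologies over \<open>A j\<close> in degrees \<open>p\<close> and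
  \<open>p - 1\<close>. Both vanish by induction; for \<open>j = 0\<close> this is acyclicity of the
  regular sequence \<open>q\<close>.\<close>

lemma homology_vanishes:
  assumes "j \<le> k" "j < p" "\<And>B. in_vars N (\<omega> B)" "kcyc (A j) q R p \<omega>"
  shows "kbnd N (A j) q R p \<omega>"
  using assms
proof (induction j arbitrary: p \<omega>)
  case 0
  have "kbnd N {0} q R p \<omega>"
    by (rule koszul_acyclic[OF q_vars q_regular 0(3)]) (use 0(2,4) in simp_all)
  then show ?case by simp
next
  case (Suc j)
  then obtain p' where p: "p = Suc p'" "j < p'" by (cases p) auto
  have jk: "j < k" using Suc by simp
  have "\<forall>B. B \<subseteq> {..<R} \<longrightarrow> card B = p' \<longrightarrow> d \<omega> B \<in> A (Suc j)"
    using Suc.prems(4) by (auto simp: kcyc_def p)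
  \<comment> \<open>\<open>\<zeta>\<close> represents the image of \<open>\<omega>\<close> under the
    connecting homomorphism.\<close>
  from A_Suc_chain[OF this] obtain \<zeta> where \<zeta>: "\<And>B. in_vars N (\<zeta> B)"
      "\<And>B. B \<subseteq> {..<R} \<Longrightarrow> card B = p' \<Longrightarrow> d \<omega> B - b j * \<zeta> B \<in> A j"
    by blast
  have "d \<zeta> B \<in> A j" if B: "B \<subseteq> {..<R}" "Suc (card B) = p'" for B
  proof -
    have "d (\<lambda>B. d \<omega> B - b j * \<zeta> B) B \<in> A j"
      by (rule d_in_A) (use B \<zeta> in auto)
    then have "- (b j * d \<zeta> B) \<in> A j"
      by (simp add: kd_diff kd_scale kd_kd[OF finite_index[OF B(1)]])
    from gen_ideal_uminus[OF this] have "b j * d \<zeta> B \<in> A j" by simp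
    then show ?thesis by (rule A_mult_b_cancel[OF jk d_vars[OF \<zeta>(1)]])
  qed
  then have "kbnd N (A j) q R p' \<zeta>"
    using \<zeta> jk p by (intro Suc.IH) (auto simp: kcyc_def)
  then obtain \<xi> where \<xi>: "\<And>B. in_vars N (\<xi> B)"
      "\<And>B. B \<subseteq> {..<R} \<Longrightarrow> card B = p' \<Longrightarrow> \<zeta> B - d \<xi> B \<in> A j"
    unfolding kbnd_def by blast
  \<comment> \<open>Since \<open>\<zeta>\<close> is the boundary of \<open>\<xi>\<close> modulo
    \<open>A j\<close>, this correction, invisible modulo \<open>A (Suc j)\<close>, turns
    \<open>\<omega>\<close> into a cycle modulo \<open>A j\<close>.\<close>
  define \<omega>' where "\<omega>' = (\<lambda>B. \<omega> B - b j * \<xi> B)"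
  have "d \<omega>' B \<in> A j" if B: "B \<subseteq> {..<R}" "card B = p'" for B
  proof -
    have "d \<omega>' B = (d \<omega> B - b j * \<zeta> B) + b j * (\<zeta> B - d \<xi> B)"
      by (simp add: \<omega>'_def kd_diff kd_scale right_diff_distrib mult.left_commute)
    then show ?thesis using \<zeta>(2)[OF B] \<xi>(2)[OF B] b_vars[OF jk] by auto
  qed
  then have "kbnd N (A j) q R p \<omega>'"
    using \<xi>(1) jk p Suc.prems by (intro Suc.IH) (auto simp: kcyc_def \<omega>'_def b_vars)
  then obtain \<eta> where \<eta>: "\<And>B. in_vars N (\<eta> B)"
      "\<And>B. B \<subseteq> {..<R} \<Longrightarrow> card B = p \<Longrightarrow> \<omega>' B - d \<eta> B \<in> A j"
    unfolding kbnd_def by blast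
  have "\<omega> B - d \<eta> B \<in> A (Suc j)" if B: "B \<subseteq> {..<R}" "card B = p" for B
  proof -
    have "\<omega> B - d \<eta> B = (\<omega>' B - d \<eta> B) + b j * \<xi> B" by (simp add: \<omega>'_def)
    also have "\<dots> \<in> A (Suc j)"
      by (intro gen_ideal_add gen_ideal_Suc[OF \<eta>(2)[OF B]] b_mult_in_A_Suc[OF jk \<xi>(1)])
    finally show ?thesis .
  qed
  then show ?case by (rule kbndI[OF \<eta>(1)])
qed

text \<open>The forms \<open>b i\<close> with \<open>i < j\<close> are already zero modulo
  \<open>A j\<close>, so for a cycle this says that its class is killed by all the linear
  forms.\<close>

definition annihilated :: "nat \<Rightarrow> (nat set \<Rightarrow> 'a mpoly) \<Rightarrow> bool" where
  "annihilated j \<omega> \<longleftrightarrow> (\<forall>i. j \<le> i \<and> i < k \<longrightarrow> kbnd N (A j) q R j (\<lambda>B. b i * \<omega> B))"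

text \<open>The connecting homomorphism of
\<open>0 \<longrightarrow> S/A j \<longrightarrow> S/A j \<longrightarrow> S/A (Suc j) \<longrightarrow> 0\<close> (first map: multiplication by \<open>b j\<close>)
identifies the classes killed by \<open>b j\<close> in homological degree \<open>j\<close> with classes in degree
\<open>Suc j\<close> over the smaller ring.  Since the \<open>q i\<close> are quadratic and \<open>b j\<close> is linear, the
polynomial degree drops by one.\<close>

lemma annihilated_lift:
  assumes jk: "j < k" and v: "\<And>B. in_vars N (\<omega> B)" and h: "\<And>B. homog e (\<omega> B)"
    and ann: "annihilated j \<omega>"
  shows "\<exists>\<eta>. (\<forall>B. in_vars N (\<eta> B)) \<and> (\<forall>B. if e = 0 then \<eta> B = 0 else homog (e - 1) (\<eta> B)) \<and>
    (\<forall>B. B \<subseteq> {..<R} \<longrightarrow> card B = j \<longrightarrow> b j * \<omega> B - d \<eta> B \<in> A j) \<and>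
    kcyc (A (Suc j)) q R (Suc j) \<eta> \<and> annihilated (Suc j) \<eta>"
proof -
  from ann jk obtain \<eta>\<^sub>0 where \<eta>0: "\<And>B. in_vars N (\<eta>\<^sub>0 B)"
      "\<And>B. B \<subseteq> {..<R} \<Longrightarrow> card B = j \<Longrightarrow> b j * \<omega> B - d \<eta>\<^sub>0 B \<in> A j"
    unfolding annihilated_def kbnd_def by blast
  \<comment> \<open>\<open>b j * \<omega> B\<close> has degree \<open>e + 1\<close> and
    \<open>d\<close> raises degrees by 2, so only the component of degree \<open>e - 1\<close>
    matters; for \<open>e = 0\<close> there is none.\<close>
  define \<eta> where "\<eta> = (\<lambda>B. if e = 0 then 0 else hcomp (e - 1) (\<eta>\<^sub>0 B))"
  have \<eta>v: "\<And>B. in_vars N (\<eta> B)" using \<eta>0(1) by (simp add: \<eta>_def)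
  have \<eta>h: "\<And>B. if e = 0 then \<eta> B = 0 else homog (e - 1) (\<eta> B)" by (simp add: \<eta>_def)
  have \<eta>: "b j * \<omega> B - d \<eta> B \<in> A j" if B: "B \<subseteq> {..<R}" "card B = j" for B
  proof -
    have "hcomp (Suc e) (b j * \<omega> B - d \<eta>\<^sub>0 B) \<in> A j"
      by (rule gen_ideal_hcomp[OF \<eta>0(2)[OF B], where e = 1]) (use b_homog jk in auto)
    moreover have "homog (Suc e) (b j * \<omega> B)"
      using homog_mult[OF b_homog[OF jk] h[of B]] by simp
    ultimately show ?thesis
      by (cases e) (simp_all add: hcomp_diff hcomp_homog hcomp_d \<eta>_def)
  qed
  have \<eta>A: "d \<eta> B \<in> A (Suc j)" if B: "B \<subseteq> {..<R}" "card B = j" for B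
  proof -
    have "d \<eta> B = b j * \<omega> B - (b j * \<omega> B - d \<eta> B)" by simp
    also have "\<dots> \<in> A (Suc j)" 
      by (intro gen_ideal_diff b_mult_in_A_Suc[OF jk v] gen_ideal_Suc[OF \<eta>[OF B]])
    finally show ?thesis .
  qed
  have "kbnd N (A (Suc j)) q R (Suc j) (\<lambda>B. b i * \<eta> B)" if i: "Suc j \<le> i" "i < k" for i
  proof -
    from ann i obtain \<zeta> where \<zeta>: "\<And>B. in_vars N (\<zeta> B)"
        "\<And>B. B \<subseteq> {..<R} \<Longrightarrow> card B = j \<Longrightarrow> b i * \<omega> B - d \<zeta> B \<in> A j"
      unfolding annihilated_def kbnd_def by (meson Suc_leD)
    \<comment> \<open>Modulo \<open>A j\<close>, both \<open>d (\<lambda>B. b i * \<eta> B)\<close>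
      and \<open>d (\<lambda>B. b j * \<zeta> B)\<close> equal \<open>b i * b j * \<omega>\<close>.
      So \<open>\<tau>\<close> is a cycle of degree \<open>Suc j\<close>, where homology over
      \<open>A j\<close> vanishes, and modulo \<open>A (Suc j)\<close> it is
      \<open>b i * \<eta>\<close>.\<close>
    define \<tau> where "\<tau> = (\<lambda>B. b i * \<eta> B - b j * \<zeta> B)"
    have \<tau>v: "in_vars N (\<tau> B)" for B using \<eta>v \<zeta>(1) b_vars i jk by (auto simp: \<tau>_def)
    have "d \<tau> B \<in> A j" if B: "B \<subseteq> {..<R}" "card B = j" for B
    proof -
      have "d \<tau> B = b j * (b i * \<omega> B - d \<zeta> B) - b i * (b j * \<omega> B - d \<eta> B)"
        by (simp add: \<tau>_def kd_diff kd_scale right_diff_distrib mult.left_commute)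
      also have "\<dots> \<in> A j"
        by (intro gen_ideal_diff gen_ideal_mult_left \<zeta>(2)[OF B] \<eta>[OF B] b_vars jk i(2))
      finally show ?thesis .
    qed
    then have "kbnd N (A j) q R (Suc j) \<tau>"
      using \<tau>v jk by (intro homology_vanishes) (auto simp: kcyc_def)
    then obtain \<xi> where \<xi>: "\<And>B. in_vars N (\<xi> B)"
        "\<And>B. B \<subseteq> {..<R} \<Longrightarrow> card B = Suc j \<Longrightarrow> \<tau> B - d \<xi> B \<in> A j"
      unfolding kbnd_def by blast
    have "b i * \<eta> B - d \<xi> B \<in> A (Suc j)" if B: "B \<subseteq> {..<R}" "card B = Suc j" for B
    proof -
      have "b i * \<eta> B - d \<xi> B = (\<tau> B - d \<xi> B) + b j * \<zeta> B" by (simp add: \<tau>_def)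
      also have "\<dots> \<in> A (Suc j)"
        by (intro gen_ideal_add gen_ideal_Suc[OF \<xi>(2)[OF B]] b_mult_in_A_Suc[OF jk \<zeta>(1)])
      finally show ?thesis .
    qed
    then show ?thesis by (rule kbndI[OF \<xi>(1)])
  qed
  then have "annihilated (Suc j) \<eta>" by (simp add: annihilated_def)
  moreover have "kcyc (A (Suc j)) q R (Suc j) \<eta>" using \<eta>A by (simp add: kcyc_def)
  ultimately show ?thesis
    by (intro exI[of _ \<eta>] conjI allI impI) (assumption | rule \<eta>v \<eta>h | rule \<eta>)+
qed

text \<open>Injectivity of the connecting homomorphism: from
  \<open>\<eta> = d \<xi> + b j * \<zeta>\<close> modulo \<open>A j\<close> follows
  \<open>b j * \<omega> = b j * d \<zeta>\<close>, and \<open>b j\<close> cancels.\<close>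

lemma boundary_descend:
  assumes jk: "j < k" and v: "\<And>B. in_vars N (\<omega> B)"
    and \<eta>: "\<And>B. B \<subseteq> {..<R} \<Longrightarrow> card B = j \<Longrightarrow> b j * \<omega> B - d \<eta> B \<in> A j"
    and bnd: "kbnd N (A (Suc j)) q R (Suc j) \<eta>"
  shows "kbnd N (A j) q R j \<omega>"
proof -
  obtain \<xi> where \<xi>: "\<forall>B. in_vars N (\<xi> B)"
      "\<forall>B. B \<subseteq> {..<R} \<longrightarrow> card B = Suc j \<longrightarrow> \<eta> B - d \<xi> B \<in> A (Suc j)"
    using bnd unfolding kbnd_def by blast
  from A_Suc_chain[OF \<xi>(2)] obtain \<zeta> where \<zeta>: "\<And>B. in_vars N (\<zeta> B)"
      "\<And>B. B \<subseteq> {..<R} \<Longrightarrow> card B = Suc j \<Longrightarrow> \<eta> B - d \<xi> B - b j * \<zeta> B \<in> A j"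
    by blast
  have "\<omega> B - d \<zeta> B \<in> A j" if B: "B \<subseteq> {..<R}" "card B = j" for B
  proof -
    have "d (\<lambda>B. \<eta> B - d \<xi> B - b j * \<zeta> B) B \<in> A j"
      by (rule d_in_A) (use B \<zeta> in auto)
    then have "d \<eta> B - b j * d \<zeta> B \<in> A j"
      by (simp add: kd_diff kd_scale kd_kd[OF finite_index[OF B(1)]])
    with \<eta>[OF B] have "(b j * \<omega> B - d \<eta> B) + (d \<eta> B - b j * d \<zeta> B) \<in> A j" by (rule gen_ideal_add)
    then have "b j * (\<omega> B - d \<zeta> B) \<in> A j" by (simp add: algebra_simps)
    from A_mult_b_cancel[OF jk _ this] show ?thesis using v d_vars[OF \<zeta>(1)] by simp
  qed
  then show ?thesis by (rule kbndI[OF \<zeta>(1)])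
qed

text \<open>Each lift raises \<open>j\<close> and lowers the polynomial degree by one. As
  \<open>j + e < k\<close>, the degree runs out before the linear forms do; the last lift is then 0,
  and \<open>boundary_descend\<close> carries this back.\<close>

lemma annihilated_low_degree:
  assumes "j + e < k" "\<And>B. in_vars N (\<omega> B)" "\<And>B. homog e (\<omega> B)" "annihilated j \<omega>"
  shows "kbnd N (A j) q R j \<omega>"
  using assms
proof (induction e arbitrary: j \<omega>)
  case 0
  then obtain \<eta> where \<eta>: "\<And>B. \<eta> B = 0"
    "\<And>B. B \<subseteq> {..<R} \<Longrightarrow> card B = j \<Longrightarrow> b j * \<omega> B - d \<eta> B \<in> A j"
    using annihilated_lift[of j \<omega> 0] by auto
  have "kbnd N (A (Suc j)) q R (Suc j) \<eta>"
    unfolding kbnd_def by (rule exI[of _ "\<lambda>_. 0"]) (use \<eta> in auto)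
  then show ?case using 0 \<eta> by (intro boundary_descend[of j \<omega> \<eta>]) auto
next
  case (Suc e)
  then obtain \<eta> where \<eta>: "\<And>B. in_vars N (\<eta> B)" "\<And>B. homog e (\<eta> B)"
    "\<And>B. B \<subseteq> {..<R} \<Longrightarrow> card B = j \<Longrightarrow> b j * \<omega> B - d \<eta> B \<in> A j" "annihilated (Suc j) \<eta>"
    using annihilated_lift[of j \<omega> "Suc e"] by auto
  have "kbnd N (A (Suc j)) q R (Suc j) \<eta>"
    using Suc.prems \<eta> by (intro Suc.IH) auto
  then show ?case using Suc.prems \<eta> by (intro boundary_descend[of j \<omega> \<eta>]) auto
qed

end

section \<open>Constant cycles and the critical degree\<close>

lemma const_ksgn [simp]: "const (ksgn i B) = (ksgn i B :: 'a::comm_ring_1 mpoly)"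
  by (simp add: ksgn_def)

lemma homog_0_eq_const:
  assumes "homog 0 f" shows "f = const (Poly_Mapping.lookup f 0)"
proof (rule poly_mapping_eqI)
  fix m
  have "m = 0" if "m \<in> Poly_Mapping.keys f"
  proof -
    have "\<forall>v\<in>Poly_Mapping.keys m. Poly_Mapping.lookup m v = 0"
      using assms that by (auto simp: homog_def mdeg_def)
    then show "m = 0" by (intro poly_mapping_eqI) (auto simp: in_keys_iff)
  qed
  then show "Poly_Mapping.lookup f m = Poly_Mapping.lookup (const (Poly_Mapping.lookup f 0)) m"
    by (cases "m \<in> Poly_Mapping.keys f") (auto simp: const_def lookup_single when_def in_keys_iff)
qed

context quadrics_and_linear_forms
begin

text \<open>The coefficients of a constant cycle modulo \<open>A k\<close> are cut out by linear algebra: the cycle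
is an exterior power element of the space of relations among the \<open>q i\<close> modulo \<open>A k\<close>, and this
space has dimension at most \<open>k\<close> because there are no constant cycles of degree \<open>Suc k\<close>.\<close>

lemma const_cycle_Suc_eq_0:
  assumes "kcyc (A k) q R (Suc k) (\<lambda>B. const (w B))" "B \<subseteq> {..<R}" "card B = Suc k"
  shows "w B = 0"
proof -
  have "kbnd N (A k) q R (Suc k) (\<lambda>B. const (w B))"
    using assms(1) by (intro homology_vanishes) auto
  then obtain \<eta> where "const (w B) - d \<eta> B \<in> A k"
    unfolding kbnd_def using assms by blast
  \<comment> \<open>In degree 0 only \<open>w B\<close> is left: boundaries start in degree 2 and
    \<open>A k\<close> starts in degree 1.\<close>
  then have "hcomp 0 (const (w B) - d \<eta> B) = 0"
    by (rule gen_ideal_hcomp_less[where e = 1]) (use b_homog in auto)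
  then show ?thesis by (simp add: hcomp_diff hcomp_d hcomp_homog)
qed

lemma const_cycles_dim_le_1:
  "\<exists>D\<subseteq>{..<R}. \<forall>w. kcyc (A k) q R k (\<lambda>B. const (w B)) \<and> w D = 0
     \<longrightarrow> (\<forall>B\<subseteq>{..<R}. card B = k \<longrightarrow> w B = 0)"
proof -
  \<comment> \<open>A maximal set \<open>S\<close> of quadrics independent modulo \<open>A k\<close>
    is chosen below. Its complement \<open>D\<close> indexes a basis of the constant relations, and
    a constant cycle will be determined by its value at \<open>D\<close>.\<close>
  define indep where "indep = (\<lambda>S. S \<subseteq> {..<R} \<and>
    (\<forall>c. (\<Sum>i\<in>S. const (c i) * q i) \<in> A k \<longrightarrow> (\<forall>i\<in>S. c i = 0)))"
  have "finite {S. indep S}" by (rule finite_subset[of _ "Pow {..<R}"]) (auto simp: indep_def)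
  moreover have "{} \<in> {S. indep S}" by (simp add: indep_def)
  ultimately obtain S where S: "indep S" "\<And>T. indep T \<Longrightarrow> S \<subseteq> T \<Longrightarrow> S = T"
    using finite_has_maximal[of "{S. indep S}"] by blast
  define D where "D = {..<R} - S"
  have SR: "S \<subseteq> {..<R}" using S(1) by (simp add: indep_def)
  then have finS: "finite S" by (rule finite_index)
  have rel: "\<exists>v. (\<Sum>i<R. const (v i) * q i) \<in> A k \<and> v j = 1 \<and> (\<forall>i\<in>D - {j}. v i = 0)"
    if j: "j \<in> D" for j
  proof -
    have "\<not> indep (insert j S)" using S(2)[of "insert j S"] j by (auto simp: D_def)
    moreover have "insert j S \<subseteq> {..<R}" using SR j by (auto simp: D_def)
    ultimately obtain c where c: "(\<Sum>i\<in>insert j S. const (c i) * q i) \<in> A k" "\<exists>i\<in>insert j S. c i \<noteq> 0"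
      by (auto simp: indep_def)
    have cj: "c j \<noteq> 0"
    proof
      assume "c j = 0"
      then have "(\<Sum>i\<in>S. const (c i) * q i) \<in> A k" using c(1) finS j by (simp add: D_def)
      then have "\<forall>i\<in>S. c i = 0" using S(1) by (simp add: indep_def)
      with c(2) \<open>c j = 0\<close> show False by auto
    qed
    define v where "v = (\<lambda>i. if i \<in> insert j S then c i / c j else 0)"
    have "(\<Sum>i<R. const (v i) * q i) = (\<Sum>i\<in>insert j S. const (v i) * q i)"
      using \<open>insert j S \<subseteq> {..<R}\<close> by (intro sum.mono_neutral_right) (auto simp: v_def)
    also have "\<dots> = (\<Sum>i\<in>insert j S. const (1 / c j) * (const (c i) * q i))"
      by (intro sum.cong) (auto simp: v_def simp flip: const_mult mult.assoc)
    also have "\<dots> = const (1 / c j) * (\<Sum>i\<in>insert j S. const (c i) * q i)"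
      by (rule sum_distrib_left[symmetric])
    also have "\<dots> \<in> A k" using c(1) by (rule gen_ideal_mult_left) simp
    finally show ?thesis using cj by (intro exI[of _ v]) (auto simp: v_def D_def)
  qed
  have "w B = 0" if w: "kcyc (A k) q R k (\<lambda>B. const (w B))" "w D = 0"
    and B: "B \<subseteq> {..<R}" "card B = k" for w B
  proof -
    \<comment> \<open>Wedging \<open>w\<close> with the relation \<open>v\<close> belonging to some
      \<open>j\<close> in \<open>D\<close> outside \<open>B\<close> gives a constant cycle of degree
      \<open>Suc k\<close>, hence zero. Its value at \<open>insert j B\<close> is \<open>w B\<close>
      up to sign, because \<open>v\<close> vanishes on the rest of \<open>D\<close>.\<close>
    have inD: "w B = 0" if B: "B \<subseteq> D" "card B = k" "B \<noteq> D" for B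
    proof -
      obtain j where j: "j \<in> D" "j \<notin> B" using B by blast
      have finB: "finite B" using B(1) by (rule finite_subset) (simp add: D_def)
      obtain v where v: "(\<Sum>i<R. const (v i) * q i) \<in> A k" "v j = 1" "\<forall>i\<in>D - {j}. v i = 0"
        using rel[OF j(1)] by blast
      define w' where "w' = (\<lambda>C. \<Sum>i\<in>C. ksgn i (C - {i}) * v i * w (C - {i}))"
      have w': "(\<lambda>C. const (w' C)) = kwedge (\<lambda>i. const (v i)) (\<lambda>C. const (w C))"
        by (auto simp: w'_def kwedge_def const_sum)
      have "d (\<lambda>C. const (w' C)) C \<in> A k" if C: "C \<subseteq> {..<R}" "card C = k" for C
      proof -
        have "d (\<lambda>C. const (w C)) (C - {i}) \<in> A k" if "i \<in> C" for i
        proof -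
          have "Suc (card (C - {i})) = k" using that C finite_index[OF C(1)] by (metis card_Suc_Diff1)
          moreover have "C - {i} \<subseteq> {..<R}" using C(1) by blast
          ultimately show ?thesis using w(1) by (simp add: kcyc_def)
        qed
        then have "kwedge (\<lambda>i. const (v i)) (d (\<lambda>C. const (w C))) C \<in> A k"
          unfolding kwedge_def by (intro gen_ideal_sum gen_ideal_mult_left) auto
        moreover have "(\<Sum>i<R. const (v i) * q i) * const (w C) \<in> A k"
          using v(1) by (rule gen_ideal_mult_right) simp
        ultimately show ?thesis unfolding w' kd_kwedge[OF C(1)] by (rule gen_ideal_diff[rotated])
      qed
      then have "kcyc (A k) q R (Suc k) (\<lambda>C. const (w' C))" by (simp add: kcyc_def)
      then have "w' (insert j B) = 0"
        by (rule const_cycle_Suc_eq_0) (use B j finB in \<open>auto simp: D_def\<close>)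
      moreover have "w' (insert j B) = ksgn j B * w B"
      proof -
        have "(\<Sum>i\<in>B. ksgn i (insert j B - {i}) * v i * w (insert j B - {i})) = 0"
          using v(3) B(1) j by (intro sum.neutral) auto
        then show ?thesis using j finB v(2) by (simp add: w'_def)
      qed
      ultimately show "w B = 0" using ksgn_cases[of j B, where 'b='a] by auto
    qed
    \<comment> \<open>Induction on the number of indices in \<open>S\<close>. Removing one of them,
      \<open>l\<close>, and reading the cycle condition at the remaining set \<open>C\<close> gives
      a relation: terms with index in \<open>D\<close> vanish by induction, so independence of
      \<open>S\<close> kills the coefficient at \<open>l\<close>.\<close>
    show "w B = 0" using B
    proof (induction "card (B \<inter> S)" arbitrary: B rule: less_induct)
      case less
      have finB: "finite B" using less.prems(1) by (rule finite_index)
      show ?case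
      proof (cases "B \<inter> S = {}")
        case True
        then have "B \<subseteq> D" using less.prems by (auto simp: D_def)
        then show ?thesis using inD w(2) less.prems by blast
      next
        case False
        then obtain l where l: "l \<in> B" "l \<in> S" by blast
        define C where "C = B - {l}"
        have BC: "B = insert l C" "l \<notin> C" using l by (auto simp: C_def)
        have C: "C \<subseteq> {..<R}" "Suc (card C) = k" "finite C"
          using less.prems finB card_Suc_Diff1[OF finB l(1)] unfolding C_def by auto
        define c where "c = (\<lambda>i. if i \<in> C then 0 else ksgn i C * w (insert i C))"
        have zero: "w (insert i C) = 0" if i: "i \<in> D - C" for i
        proof (rule less.hyps)
          have "insert i C \<inter> S = C \<inter> S" using i by (auto simp: D_def)
          moreover have "C \<inter> S \<subset> B \<inter> S" using l by (auto simp: C_def)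
          ultimately show "card (insert i C \<inter> S) < card (B \<inter> S)"
            using finB by (simp add: psubset_card_mono)
        qed (use C i in \<open>auto simp: D_def\<close>)
        have "d (\<lambda>B. const (w B)) C = (\<Sum>i\<in>S. const (c i) * q i)"
        proof -
          have "d (\<lambda>B. const (w B)) C = (\<Sum>i\<in>{..<R} - C. const (c i) * q i)"
            unfolding kd_def by (intro sum.cong) (auto simp: c_def)
          also have "\<dots> = (\<Sum>i\<in>S - C. const (c i) * q i)"
            using SR zero by (intro sum.mono_neutral_right) (auto simp: c_def D_def)
          also have "\<dots> = (\<Sum>i\<in>S. const (c i) * q i)"
            using finS by (intro sum.mono_neutral_left) (auto simp: c_def)
          finally show ?thesis .
        qed
        moreover have "d (\<lambda>B. const (w B)) C \<in> A k" using w(1) C by (simp add: kcyc_def)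
        ultimately have "c l = 0" using S(1) l(2) by (simp add: indep_def)
        then have "ksgn l C * w (insert l C) = 0" using BC(2) by (simp add: c_def)
        then have "ksgn l C * (ksgn l C * w (insert l C)) = 0" by (simp only: mult_zero_right)
        then show ?thesis unfolding ksgn_square_mult BC(1)[symmetric] .
      qed
    qed
  qed
  then show ?thesis by (intro exI[of _ D]) (auto simp: D_def)
qed

text \<open>Both classes are lifted in parallel until they are constant cycles for
  \<open>j = k\<close>, where the space is at most one-dimensional. The lifts are linear, so the
  dependency found there descends with the same \<open>\<alpha>\<close> and
  \<open>\<beta>\<close>.\<close>

lemma annihilated_critical_degree:
  assumes "j + e = k"
    and "\<And>B. in_vars N (\<omega> B)" "\<And>B. homog e (\<omega> B)" "kcyc (A j) q R j \<omega>" "annihilated j \<omega>"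
    and "\<And>B. in_vars N (\<omega>' B)" "\<And>B. homog e (\<omega>' B)" "kcyc (A j) q R j \<omega>'" "annihilated j \<omega>'"
  shows "\<exists>\<alpha> \<beta>. (\<alpha> \<noteq> 0 \<or> \<beta> \<noteq> 0) \<and> kbnd N (A j) q R j (\<lambda>B. const \<alpha> * \<omega> B + const \<beta> * \<omega>' B)"
  using assms
proof (induction e arbitrary: j \<omega> \<omega>')
  case 0
  define w where "w = (\<lambda>B. Poly_Mapping.lookup (\<omega> B) 0)"
  define w' where "w' = (\<lambda>B. Poly_Mapping.lookup (\<omega>' B) 0)"
  have \<omega>: "\<omega> = (\<lambda>B. const (w B))" "\<omega>' = (\<lambda>B. const (w' B))"
    using homog_0_eq_const[OF "0.prems"(3)] homog_0_eq_const[OF "0.prems"(7)] by (auto simp: w_def w'_def)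
  have j: "j = k" using 0 by simp
  obtain D where D: "\<And>w. kcyc (A k) q R k (\<lambda>B. const (w B)) \<Longrightarrow> w D = 0
     \<Longrightarrow> (\<forall>B\<subseteq>{..<R}. card B = k \<longrightarrow> w B = 0)"
    using const_cycles_dim_le_1 by blast
  obtain \<alpha> \<beta> where ab: "\<alpha> \<noteq> 0 \<or> \<beta> \<noteq> 0" "\<alpha> * w D + \<beta> * w' D = 0"
  proof (cases "w D = 0")
    case True
    then show thesis using that[of 1 0] by simp
  next
    case False
    then show thesis using that[of "w' D" "- w D"] by simp
  qed
  have "d (\<lambda>B. const (\<alpha> * w B + \<beta> * w' B)) B = const \<alpha> * d \<omega> B + const \<beta> * d \<omega>' B" for B
    by (simp add: \<omega> kd_add kd_scale)
  then have "kcyc (A k) q R k (\<lambda>B. const (\<alpha> * w B + \<beta> * w' B))"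
    using "0.prems"(4,8) unfolding kcyc_def j
    by (simp only:) (intro allI impI gen_ideal_add gen_ideal_mult_left in_vars_const; blast)
  from D[of "\<lambda>B. \<alpha> * w B + \<beta> * w' B", OF this ab(2)]
  have "\<forall>B\<subseteq>{..<R}. card B = k \<longrightarrow> const \<alpha> * \<omega> B + const \<beta> * \<omega>' B = 0"
    by (simp add: \<omega> flip: const_mult const_add)
  then have "kbnd N (A j) q R j (\<lambda>B. const \<alpha> * \<omega> B + const \<beta> * \<omega>' B)"
    unfolding j by (intro kbndI[of N "\<lambda>_. 0"]) auto
  with ab(1) show ?case by blast
next
  case (Suc e)
  then have jk: "j < k" by simp
  from annihilated_lift[OF jk Suc.prems(2,3,5)] obtain \<eta> where
    \<eta>: "\<And>B. in_vars N (\<eta> B)" "\<And>B. homog e (\<eta> B)"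
      "\<And>B. B \<subseteq> {..<R} \<Longrightarrow> card B = j \<Longrightarrow> b j * \<omega> B - d \<eta> B \<in> A j"
      "kcyc (A (Suc j)) q R (Suc j) \<eta>" "annihilated (Suc j) \<eta>" by auto
  from annihilated_lift[OF jk Suc.prems(6,7,9)] obtain \<eta>' where
    \<eta>': "\<And>B. in_vars N (\<eta>' B)" "\<And>B. homog e (\<eta>' B)"
      "\<And>B. B \<subseteq> {..<R} \<Longrightarrow> card B = j \<Longrightarrow> b j * \<omega>' B - d \<eta>' B \<in> A j"
      "kcyc (A (Suc j)) q R (Suc j) \<eta>'" "annihilated (Suc j) \<eta>'" by auto
  obtain \<alpha> \<beta> where ab: "\<alpha> \<noteq> 0 \<or> \<beta> \<noteq> 0"
      "kbnd N (A (Suc j)) q R (Suc j) (\<lambda>B. const \<alpha> * \<eta> B + const \<beta> * \<eta>' B)"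
    using Suc.IH[of "Suc j", OF _ \<eta>(1,2,4,5) \<eta>'(1,2,4,5)] Suc.prems(1) by auto
  have "b j * (const \<alpha> * \<omega> B + const \<beta> * \<omega>' B) - d (\<lambda>B. const \<alpha> * \<eta> B + const \<beta> * \<eta>' B) B \<in> A j"
    if B: "B \<subseteq> {..<R}" "card B = j" for B
  proof -
    have "b j * (const \<alpha> * \<omega> B + const \<beta> * \<omega>' B) - d (\<lambda>B. const \<alpha> * \<eta> B + const \<beta> * \<eta>' B) B
        = const \<alpha> * (b j * \<omega> B - d \<eta> B) + const \<beta> * (b j * \<omega>' B - d \<eta>' B)"
      by (simp add: kd_add kd_scale distrib_left right_diff_distrib mult.left_commute)
    also have "\<dots> \<in> A j"
      by (intro gen_ideal_add gen_ideal_mult_left \<eta>(3)[OF B] \<eta>'(3)[OF B] in_vars_const)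
    finally show ?thesis .
  qed
  then have "kbnd N (A j) q R j (\<lambda>B. const \<alpha> * \<omega> B + const \<beta> * \<omega>' B)"
    by (intro boundary_descend[OF jk _ _ ab(2)]) (simp_all add: Suc.prems(2,6))
  with ab(1) show ?case by blast
qed

abbreviation I :: "'a mpoly set" where "I \<equiv> gen_ideal N q R"

lemma kbnd_0_iff_in_I: "kbnd N (A 0) q R 0 (\<lambda>_. f) \<longleftrightarrow> f \<in> I"
  using kbnd_0_iff[of R N q "\<lambda>_. f"] q_vars by simp

lemma annihilated_0_iff: "annihilated 0 (\<lambda>_. f) \<longleftrightarrow> (\<forall>i<k. b i * f \<in> I)"
  unfolding annihilated_def kbnd_0_iff_in_I by simp

text \<open>The case \<open>j = 0\<close>: since \<open>A 0 = {0}\<close>, homology in degree 0 is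
  the quotient ring modulo \<open>I\<close>.\<close>

theorem annihilator_low_degree:
  assumes "in_vars N f" "homog e f" "e < k" "\<And>i. i < k \<Longrightarrow> b i * f \<in> I"
  shows "f \<in> I"
  using annihilated_low_degree[of 0 e "\<lambda>_. f"] assms
  unfolding kbnd_0_iff_in_I annihilated_0_iff by simp

theorem annihilator_critical_degree:
  assumes "in_vars N f" "homog k f" "\<And>i. i < k \<Longrightarrow> b i * f \<in> I"
    and "in_vars N g" "homog k g" "\<And>i. i < k \<Longrightarrow> b i * g \<in> I"
  shows "\<exists>\<alpha> \<beta>. (\<alpha> \<noteq> 0 \<or> \<beta> \<noteq> 0) \<and> const \<alpha> * f + const \<beta> * g \<in> I"
  using annihilated_critical_degree[of 0 k "\<lambda>_. f" "\<lambda>_. g"] assms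
  unfolding kbnd_0_iff_in_I annihilated_0_iff by (simp add: kcyc_def)

end

subsection \<open>Linearly independent linear forms are a regular sequence\<close>

lemma mono_eval_var: "mono_eval var m = (Poly_Mapping.single m 1 :: 'a::comm_semiring_1 mpoly)"
proof -
  have pow: "(var v :: 'a mpoly) ^ n = Poly_Mapping.single (Poly_Mapping.single v n) 1" for v n
    by (induction n) (simp_all add: var_def mult_single flip: single_add)
  have single: "(\<Prod>v\<in>V. Poly_Mapping.single (h v) 1 :: 'a mpoly) = Poly_Mapping.single (\<Sum>v\<in>V. h v) 1"
    for V and h :: "nat \<Rightarrow> nat \<Rightarrow>\<^sub>0 nat"
    by (induction V rule: infinite_finite_induct) (simp_all add: mult_single)
  show ?thesis unfolding mono_eval_def pow single
    by (simp add: sum_single_keys[of m, symmetric])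
qed

lemma eval_hom_const_var: "eval_hom const var f = (f :: 'a::comm_semiring_1 mpoly)"
  by (simp add: eval_hom_def mono_eval_var const_def mult_single sum_single_keys[of f, symmetric])

lemma mono_eval_in_vars:
  fixes s :: "nat \<Rightarrow> 'a::comm_semiring_1 mpoly"
  shows "Poly_Mapping.keys m \<subseteq> {..<N} \<Longrightarrow> (\<And>v. v < N \<Longrightarrow> in_vars N (s v)) \<Longrightarrow> in_vars N (mono_eval s m)"
  unfolding mono_eval_def by (intro in_vars_prod in_vars_power) auto

lemma power_diff_in_gen_ideal:
  assumes "x - y \<in> gen_ideal N q j" "in_vars N x" "in_vars N y"
  shows "x ^ n - y ^ n \<in> gen_ideal N q j"
proof (induction n)
  case (Suc n)
  have "x ^ Suc n - y ^ Suc n = x * (x ^ n - y ^ n) + (x - y) * y ^ n" by (simp add: algebra_simps)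
  also have "\<dots> \<in> gen_ideal N q j"
    by (intro gen_ideal_add gen_ideal_mult_left[OF Suc.IH] gen_ideal_mult_right[OF assms(1)] assms in_vars_power)
  finally show ?case .
qed simp

lemma prod_diff_in_gen_ideal:
  assumes "finite V" "\<And>v. v \<in> V \<Longrightarrow> x v - y v \<in> gen_ideal N q j"
    "\<And>v. v \<in> V \<Longrightarrow> in_vars N (x v)" "\<And>v. v \<in> V \<Longrightarrow> in_vars N (y v)"
  shows "prod x V - prod y V \<in> gen_ideal N q j"
  using assms
proof (induction V rule: finite_induct)
  case (insert a V)
  have "prod x (insert a V) - prod y (insert a V)
      = x a * (prod x V - prod y V) + (x a - y a) * prod y V"
    using insert.hyps by (simp add: algebra_simps)
  also have "\<dots> \<in> gen_ideal N q j"
    by (intro gen_ideal_add gen_ideal_mult_left[OF insert.IH] gen_ideal_mult_right insert.prems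
        in_vars_prod) auto
  finally show ?case .
qed simp

text \<open>Congruences between \<open>var v\<close> and \<open>s v\<close> pass to powers and
  products, hence to monomials and their combinations.\<close>

lemma eval_hom_diff_in_gen_ideal:
  fixes f :: "'a::comm_ring_1 mpoly"
  assumes f: "in_vars N f" and s: "\<And>v. v < N \<Longrightarrow> in_vars N (s v)"
    and d: "\<And>v. v < N \<Longrightarrow> var v - s v \<in> gen_ideal N q j"
  shows "f - eval_hom const s f \<in> gen_ideal N q j"
proof -
  have "f - eval_hom const s f = eval_hom const var f - eval_hom const s f"
    by (simp add: eval_hom_const_var)
  also have "\<dots> = (\<Sum>m\<in>Poly_Mapping.keys f. const (Poly_Mapping.lookup f m) * (mono_eval var m - mono_eval s m))"
    by (simp add: eval_hom_def sum_subtractf right_diff_distrib)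
  also have "\<dots> \<in> gen_ideal N q j"
  proof (intro gen_ideal_sum gen_ideal_mult_left in_vars_const)
    fix m assume "m \<in> Poly_Mapping.keys f"
    then have v: "v < N" if "v \<in> Poly_Mapping.keys m" for v using f that by (auto simp: in_vars_def)
    show "mono_eval var m - mono_eval s m \<in> gen_ideal N q j"
      unfolding mono_eval_def
      by (intro prod_diff_in_gen_ideal power_diff_in_gen_ideal in_vars_power d s v in_vars_var) auto
  qed
  finally show ?thesis .
qed

text \<open>Solve \<open>l = 0\<close> for one of the variables occurring in \<open>l\<close> and substitute.\<close>

lemma linear_form_elimination:
  fixes l :: "'a::field mpoly"
  assumes l: "in_vars N l" "homog 1 l" "l \<noteq> 0"
  obtains \<psi> where "\<And>f g. \<psi> (f + g) = \<psi> f + \<psi> g" "\<And>f g. \<psi> (f * g) = \<psi> f * \<psi> g"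
    "\<And>f. in_vars N f \<Longrightarrow> in_vars N (\<psi> f)"
    "\<And>f. in_vars N f \<Longrightarrow> \<exists>g. in_vars N g \<and> f - \<psi> f = g * l"
    "\<And>f. in_vars N f \<Longrightarrow> homog 1 f \<Longrightarrow> \<exists>c. \<psi> f = f - const c * l" "\<psi> l = 0"
proof -
  define co where "co = (\<lambda>f::'a mpoly. \<lambda>v. Poly_Mapping.lookup f (Poly_Mapping.single v 1))"
  have rep: "f = (\<Sum>v<N. const (co f v) * var v)" if "in_vars N f" "homog 1 f" for f
    unfolding co_def using that by (rule linear_form_eq)
  obtain p where p: "p < N" "co l p \<noteq> 0"
  proof (rule ccontr)
    assume "\<not> thesis"
    then have "\<And>v. v < N \<Longrightarrow> co l v = 0" using that by blast
    then have "l = 0" by (subst rep[OF l(1,2)]) simp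
    with l(3) show False by blast
  qed
  \<comment> \<open>Only the pivot variable \<open>p\<close> is changed, with the factor chosen so
    that \<open>l\<close> itself is sent to 0.\<close>
  define s where "s = (\<lambda>v. var v - (if v = p then const (1 / co l p) * l else 0))"
  define \<psi> where "\<psi> = eval_hom const s"
  have add: "\<psi> (f + g) = \<psi> f + \<psi> g" for f g unfolding \<psi>_def by (rule eval_hom_add) simp_all
  have mult: "\<psi> (f * g) = \<psi> f * \<psi> g" for f g unfolding \<psi>_def by (rule eval_hom_mult) simp_all
  have zero: "\<psi> 0 = 0" by (simp add: \<psi>_def eval_hom_zero)
  have "\<psi> (const c) = const c" for c by (simp add: \<psi>_def const_def eval_hom_single)
  moreover have "\<psi> (var v) = s v" for v by (simp add: \<psi>_def var_def eval_hom_single)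
  moreover have "\<psi> (sum h A) = (\<Sum>x\<in>A. \<psi> (h x))" for h and A :: "nat set"
    by (induction A rule: infinite_finite_induct) (simp_all add: zero add)
  ultimately have lin0: "\<psi> (\<Sum>v<N. const (c v) * var v) = (\<Sum>v<N. const (c v) * s v)" for c
    by (simp add: mult)
  have lin: "\<psi> f = f - const (co f p / co l p) * l" if f: "in_vars N f" "homog 1 f" for f
  proof -
    have "(\<Sum>v<N. const (co f v) * s v) = (\<Sum>v<N. const (co f v) * var v)
        - (\<Sum>v<N. if v = p then const (co f p / co l p) * l else 0)"
      unfolding s_def right_diff_distrib sum_subtractf
      by (intro arg_cong2[where f = "(-)"] sum.cong) (auto simp flip: mult.assoc const_mult)
    also have "\<dots> = f - const (co f p / co l p) * l"
      using p(1) by (simp flip: rep[OF f])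
    finally show ?thesis using lin0[of "co f"] by (simp flip: rep[OF f])
  qed
  have sv: "in_vars N (s v)" if "v < N" for v using that l(1) by (simp add: s_def)
  have v: "in_vars N (\<psi> f)" if "in_vars N f" for f
    unfolding \<psi>_def eval_hom_def
    by (intro in_vars_sum in_vars_mult in_vars_const mono_eval_in_vars sv)
      (use that in \<open>auto simp: in_vars_def\<close>)
  have "var v - s v \<in> gen_ideal N (\<lambda>_. l) (Suc 0)" for v
    unfolding s_def gen_ideal_Suc_iff
    by (cases "v = p") (auto intro: exI[of _ "const (1 / co l p)"] exI[of _ 0])
  then have "f - \<psi> f \<in> gen_ideal N (\<lambda>_. l) (Suc 0)" if "in_vars N f" for f
    unfolding \<psi>_def using that sv by (intro eval_hom_diff_in_gen_ideal)
  then have id: "\<exists>g. in_vars N g \<and> f - \<psi> f = g * l" if "in_vars N f" for f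
    using that by (simp add: gen_ideal_Suc_iff)
  show thesis
  proof (rule that[of \<psi>])
    show "\<psi> l = 0" using lin[OF l(1,2)] p(2) by simp
  qed (use add mult v id lin in blast)+
qed

lemma lin_indep_not_lincomb_previous:
  assumes "lin_indep k (b :: nat \<Rightarrow> 'a::field mpoly)" "j < k"
  shows "b j \<noteq> (\<Sum>i<j. const (c i) * b i)"
proof
  assume eq: "b j = (\<Sum>i<j. const (c i) * b i)"
  define e where "e = (\<lambda>i. if i < j then c i else if i = j then - 1 else 0)"
  have "(\<Sum>i<k. const (e i) * b i) = (\<Sum>i<Suc j. const (e i) * b i)"
    using assms(2) by (intro sum.mono_neutral_right) (auto simp: e_def)
  also have "\<dots> = 0" using eq by (simp add: e_def)
  finally have "e j = 0" using assms unfolding lin_indep_def by blast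
  then show False by (simp add: e_def)
qed

text \<open>A substitution homomorphism whose kernel, on polynomials in the first \<open>N\<close>
  variables, is exactly the ideal of the first \<open>j\<close> forms. The last clause records that
  linear forms change only by the span of these.\<close>

definition eliminates :: "nat \<Rightarrow> (nat \<Rightarrow> 'a::field mpoly) \<Rightarrow> nat \<Rightarrow> ('a mpoly \<Rightarrow> 'a mpoly) \<Rightarrow> bool" where
  "eliminates N b j \<phi> \<longleftrightarrow> (\<forall>f g. \<phi> (f + g) = \<phi> f + \<phi> g) \<and> (\<forall>f g. \<phi> (f * g) = \<phi> f * \<phi> g) \<and>
    (\<forall>f. in_vars N f \<longrightarrow> in_vars N (\<phi> f) \<and> f - \<phi> f \<in> gen_ideal N b j) \<and>
    (\<forall>i<j. \<phi> (b i) = 0) \<and>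
    (\<forall>f. in_vars N f \<and> homog 1 f \<longrightarrow> (\<exists>c. \<phi> f = f - (\<Sum>i<j. const (c i) * b i)))"

lemma eliminatesD:
  assumes "eliminates N b j \<phi>"
  shows "\<phi> (f + g) = \<phi> f + \<phi> g" "\<phi> (f * g) = \<phi> f * \<phi> g"
    "in_vars N f \<Longrightarrow> in_vars N (\<phi> f)" "in_vars N f \<Longrightarrow> f - \<phi> f \<in> gen_ideal N b j"
    "i < j \<Longrightarrow> \<phi> (b i) = 0"
    "in_vars N f \<Longrightarrow> homog 1 f \<Longrightarrow> \<exists>c. \<phi> f = f - (\<Sum>i<j. const (c i) * b i)"
  using assms unfolding eliminates_def by blast+

text \<open>One form is eliminated at a time: after \<open>\<phi>\<close>, the form
  \<open>\<phi> (b j)\<close> is still linear, and nonzero by independence, so it can be solved for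
  a variable.\<close>

lemma linear_forms_elimination:
  fixes b :: "nat \<Rightarrow> 'a::field mpoly"
  assumes b: "\<And>i. i < k \<Longrightarrow> in_vars N (b i)" "\<And>i. i < k \<Longrightarrow> homog 1 (b i)" "lin_indep k b"
    and "j \<le> k"
  shows "\<exists>\<phi>. eliminates N b j \<phi>"
  using assms(4)
proof (induction j)
  case 0
  show ?case by (rule exI[of _ "\<lambda>f. f"]) (simp add: eliminates_def)
next
  case (Suc j)
  then obtain \<phi> where el: "eliminates N b j \<phi>"
    using Suc_leD by blast
  note add = eliminatesD(1)[OF el] and mult = eliminatesD(2)[OF el] and v = eliminatesD(3)[OF el]
    and id = eliminatesD(4)[OF el] and kill = eliminatesD(5)[OF el] and lin = eliminatesD(6)[OF el]
  have jk: "j < k" using Suc.prems by simp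
  define l where "l = \<phi> (b j)"
  have homog_lin: "homog 1 (\<phi> f)" if f: "in_vars N f" "homog 1 f" for f
  proof -
    obtain c where "\<phi> f = f - (\<Sum>i<j. const (c i) * b i)" using lin[OF f] by blast
    then show ?thesis using b(2) f jk by (auto intro!: homog_diff homog_sum homog_const_mult)
  qed
  obtain cl where cl: "l = b j - (\<Sum>i<j. const (cl i) * b i)"
    using lin[of "b j"] b jk unfolding l_def by blast
  have l: "in_vars N l" "homog 1 l" using v homog_lin b jk by (simp_all add: l_def)
  have "l \<noteq> 0" using lin_indep_not_lincomb_previous[OF b(3) jk, of cl] cl by simp
  with l obtain \<psi> where padd: "\<And>f g. \<psi> (f + g) = \<psi> f + \<psi> g" and pmult: "\<And>f g. \<psi> (f * g) = \<psi> f * \<psi> g"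
    and pv: "\<And>f. in_vars N f \<Longrightarrow> in_vars N (\<psi> f)"
    and pid: "\<And>f. in_vars N f \<Longrightarrow> \<exists>g. in_vars N g \<and> f - \<psi> f = g * l"
    and plin: "\<And>f. in_vars N f \<Longrightarrow> homog 1 f \<Longrightarrow> \<exists>c. \<psi> f = f - const c * l" and pl: "\<psi> l = 0"
    by (rule linear_form_elimination[of N l]) blast
  have p0: "\<psi> 0 = 0" by (metis padd add_left_cancel add.right_neutral)
  have lJ: "l \<in> gen_ideal N b (Suc j)"
  proof -
    have "b j - l \<in> gen_ideal N b j" using id b jk by (simp add: l_def)
    then have "b j - (b j - l) \<in> gen_ideal N b (Suc j)"
      by (intro gen_ideal_diff[OF gen_ideal_generator gen_ideal_Suc]) simp_all
    then show ?thesis by simp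
  qed
  have 1: "f - \<psi> (\<phi> f) \<in> gen_ideal N b (Suc j)" if f: "in_vars N f" for f
  proof -
    obtain g where g: "in_vars N g" "\<phi> f - \<psi> (\<phi> f) = g * l" using pid[OF v[OF f]] by blast
    have "f - \<psi> (\<phi> f) = (f - \<phi> f) + g * l" using g(2) by (simp add: algebra_simps)
    also have "\<dots> \<in> gen_ideal N b (Suc j)"
      by (intro gen_ideal_add gen_ideal_Suc[OF id[OF f]] gen_ideal_mult_left[OF lJ g(1)])
    finally show ?thesis .
  qed
  have 2: "\<psi> (\<phi> (b i)) = 0" if "i < Suc j" for i
    using that kill pl p0 by (cases "i = j") (auto simp: l_def)
  have 3: "\<exists>c. \<psi> (\<phi> f) = f - (\<Sum>i<Suc j. const (c i) * b i)" if f: "in_vars N f" "homog 1 f" for f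
  proof -
    obtain c where c: "\<phi> f = f - (\<Sum>i<j. const (c i) * b i)" using lin[OF f] by blast
    obtain e where e: "\<psi> (\<phi> f) = \<phi> f - const e * l" using plin v homog_lin f by blast
    have "\<phi> f - const e * l = f - (\<Sum>i<Suc j. const (if i = j then e else c i - e * cl i) * b i)"
      unfolding c cl by (simp add: algebra_simps sum_subtractf sum_distrib_left)
    with e show ?thesis by (intro exI) (rule trans)
  qed
  show ?case
    using 1 2 3 pv v
    by (intro exI[of _ "\<lambda>f. \<psi> (\<phi> f)"]) (simp add: eliminates_def add mult padd pmult)
qed

text \<open>Applying \<open>\<phi>\<close> gives \<open>\<phi> f * \<phi> (b j) = 0\<close> with
  \<open>\<phi> (b j)\<close> nonzero; as the polynomial ring is a domain,
  \<open>\<phi> f = 0\<close> and \<open>f\<close> is in the ideal.\<close>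

lemma linear_forms_regular:
  fixes b :: "nat \<Rightarrow> 'a::field mpoly"
  assumes b: "\<And>i. i < k \<Longrightarrow> in_vars N (b i)" "\<And>i. i < k \<Longrightarrow> homog 1 (b i)" "lin_indep k b"
    and j: "j < k" and f: "in_vars N f" "f * b j \<in> gen_ideal N b j"
  shows "f \<in> gen_ideal N b j"
proof -
  obtain \<phi> where el: "eliminates N b j \<phi>"
    using linear_forms_elimination[OF b less_imp_le[OF j]] by blast
  note add = eliminatesD(1)[OF el] and mult = eliminatesD(2)[OF el]
    and id = eliminatesD(4)[OF el] and kill = eliminatesD(5)[OF el] and lin = eliminatesD(6)[OF el]
  have zero: "\<phi> 0 = 0" by (metis add add_left_cancel add.right_neutral)
  have sum: "\<phi> (sum h A) = (\<Sum>x\<in>A. \<phi> (h x))" for h and A :: "nat set"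
    by (induction A rule: infinite_finite_induct) (simp_all add: zero add)
  obtain a where a: "f * b j = (\<Sum>i<j. a i * b i)" using gen_idealD[OF f(2)] by blast
  have "\<phi> f * \<phi> (b j) = \<phi> (\<Sum>i<j. a i * b i)" by (simp only: a flip: mult)
  also have "\<dots> = 0" by (simp add: sum mult kill)
  finally have "\<phi> f * \<phi> (b j) = 0" .
  moreover obtain c where "\<phi> (b j) = b j - (\<Sum>i<j. const (c i) * b i)"
    using lin[of "b j"] b j by blast
  then have "\<phi> (b j) \<noteq> 0" using lin_indep_not_lincomb_previous[OF b(3) j, of c] by simp
  ultimately show ?thesis using id[OF f(1)] by simp
qed

subsection \<open>Polarization\<close>

text \<open>Linear subspaces instead of ideals, so that polarization applies to \<open>I\<close> and
  also to the space \<open>U\<close> introduced later.\<close>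

definition lin_closed :: "'a::comm_ring_1 mpoly set \<Rightarrow> bool" where
  "lin_closed V \<longleftrightarrow> 0 \<in> V \<and> (\<forall>f\<in>V. \<forall>g\<in>V. f + g \<in> V) \<and> (\<forall>c. \<forall>f\<in>V. const c * f \<in> V)"

lemma lin_closedD:
  assumes "lin_closed V"
  shows "0 \<in> V" "f \<in> V \<Longrightarrow> g \<in> V \<Longrightarrow> f + g \<in> V" "f \<in> V \<Longrightarrow> const c * f \<in> V"
  using assms by (auto simp: lin_closed_def)

lemma lin_closed_diff: "lin_closed V \<Longrightarrow> f \<in> V \<Longrightarrow> g \<in> V \<Longrightarrow> f - g \<in> V"
  using lin_closedD(2)[of V f "const (- 1) * g"] lin_closedD(3)[of V g "- 1"] by simp

lemma lin_closed_sum: "lin_closed V \<Longrightarrow> (\<And>x. x \<in> X \<Longrightarrow> f x \<in> V) \<Longrightarrow> sum f X \<in> V"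
  by (induction X rule: infinite_finite_induct) (auto intro: lin_closedD)

lemma lin_closed_cancel:
  assumes "lin_closed V" "const (c :: 'a::field) * f \<in> V" "c \<noteq> 0" shows "f \<in> V"
proof -
  have "const (1 / c) * (const c * f) \<in> V" by (rule lin_closedD(3)[OF assms(1,2)])
  moreover have "const (1 / c) * (const c * f) = const (1 / c * c) * f" by (simp only: const_mult mult.assoc)
  ultimately show ?thesis using assms(3) by simp
qed

text \<open>The leading term is eliminated by comparing the values at \<open>2 * t\<close> and \<open>t\<close>.\<close>

lemma polynomial_curve_coeffs:
  fixes u :: "nat \<Rightarrow> 'a::field_char_0 mpoly"
  assumes V: "lin_closed V" and "\<And>t. (\<Sum>i\<le>n. const (t ^ i) * u i) \<in> V" "i \<le> n"
  shows "u i \<in> V"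
  using assms(2,3)
proof (induction n arbitrary: u i)
  case 0
  then show ?case using "0.prems"(1)[of 1] by simp
next
  case (Suc n)
  let ?e = "\<lambda>i. (2::'a) ^ i - 2 ^ Suc n"
  have low: "u i \<in> V" if i: "i \<le> n" for i
  proof -
    have "(\<Sum>i\<le>n. const (t ^ i) * (const (?e i) * u i)) \<in> V" for t
    proof -
      have "(\<Sum>i\<le>Suc n. const ((2 * t) ^ i) * u i) - const (2 ^ Suc n) * (\<Sum>i\<le>Suc n. const (t ^ i) * u i)
          = (\<Sum>i\<le>Suc n. const (t ^ i) * (const (?e i) * u i))"
        unfolding sum_distrib_left sum_subtractf[symmetric]
        by (intro sum.cong refl) (simp only: const_ring_simps const_mult power_mult_distrib algebra_simps)
      also have "\<dots> = (\<Sum>i\<le>n. const (t ^ i) * (const (?e i) * u i))" by simp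
      finally have eq: "(\<Sum>i\<le>Suc n. const ((2 * t) ^ i) * u i)
          - const (2 ^ Suc n) * (\<Sum>i\<le>Suc n. const (t ^ i) * u i)
          = (\<Sum>i\<le>n. const (t ^ i) * (const (?e i) * u i))" .
      show ?thesis
        by (rule subst[OF eq, where P = "\<lambda>x. x \<in> V"])
          (intro lin_closed_diff[OF V] lin_closedD(3)[OF V] Suc.prems(1))
    qed
    then have "const (?e i) * u i \<in> V" using i by (rule Suc.IH)
    moreover have "(2::nat) ^ i \<noteq> 2 ^ Suc n" using i by (subst power_inject_exp) auto
    then have "of_nat (2 ^ i) \<noteq> (of_nat (2 ^ Suc n) :: 'a)" by (simp only: of_nat_eq_iff not_False_eq_True)
    then have "?e i \<noteq> 0" by simp
    ultimately show ?thesis by (rule lin_closed_cancel[OF V])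
  qed
  show ?case
  proof (cases "i \<le> n")
    case False
    then have "i = Suc n" using Suc.prems(2) by simp
    have "(\<Sum>i\<le>Suc n. const (1 ^ i) * u i) - (\<Sum>i\<le>n. u i) \<in> V"
      using low by (intro lin_closed_diff[OF V Suc.prems(1)] lin_closed_sum[OF V]) auto
    then show ?thesis using \<open>i = Suc n\<close> by simp
  qed (rule low)
qed

lemma binomial_curve:
  fixes y :: "'a::comm_ring_1 mpoly"
  shows "(y + const t * y') ^ n * z = (\<Sum>i\<le>n. const (t ^ i) * (const (of_nat (n choose i)) * (y ^ (n - i) * y' ^ i * z)))"
proof -
  have "const (of_nat m) = (of_nat m :: 'a mpoly)" for m by (induction m) simp_all
  then have "(const t * y' + y) ^ n * z = (\<Sum>i\<le>n. const (t ^ i) * (const (of_nat (n choose i)) * (y ^ (n - i) * y' ^ i * z)))"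
    unfolding binomial_ring sum_distrib_right
    by (intro sum.cong refl) (simp add: power_mult_distrib ac_simps)
  then show ?thesis by (simp add: add.commute)
qed

text \<open>The element sought is, up to the factor \<open>Suc a\<close>, the coefficient of
  \<open>t\<close> on the curve; characteristic 0 allows division by this factor.\<close>

lemma polarize:
  fixes y :: "'a::field_char_0 mpoly"
  assumes V: "lin_closed V" and "\<And>t. (y + const t * y') ^ Suc a * z \<in> V"
  shows "y ^ a * y' * z \<in> V"
proof -
  have "const (of_nat (Suc a choose 1)) * (y ^ (Suc a - 1) * y' ^ 1 * z) \<in> V"
  proof (rule polynomial_curve_coeffs[OF V, where n = "Suc a" and
        u = "\<lambda>i. const (of_nat (Suc a choose i)) * (y ^ (Suc a - i) * y' ^ i * z)"])
    fix t
    show "(\<Sum>i\<le>Suc a. const (t ^ i) * (const (of_nat (Suc a choose i)) * (y ^ (Suc a - i) * y' ^ i * z))) \<in> V"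
      using assms(2)[of t] unfolding binomial_curve .
  qed simp
  then have "const (of_nat (Suc a)) * (y ^ a * y' * z) \<in> V" by (simp del: of_nat_Suc)
  then show ?thesis by (rule lin_closed_cancel[OF V]) (simp del: of_nat_Suc)
qed

text \<open>Gaussian elimination: the last equation is solved for a pivot \<open>p\<close>, leaving
  one equation and one unknown fewer.\<close>

lemma underdetermined_system:
  fixes a :: "nat \<Rightarrow> nat \<Rightarrow> 'a::field"
  assumes "finite J" "j < card J"
  shows "\<exists>c. (\<exists>v\<in>J. c v \<noteq> 0) \<and> (\<forall>t<j. (\<Sum>v\<in>J. a t v * c v) = 0)"
  using assms
proof (induction j arbitrary: J a)
  case 0
  then have "J \<noteq> {}" by auto
  then show ?case by (intro exI[of _ "\<lambda>_. 1"]) auto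
next
  case (Suc j)
  show ?case
  proof (cases "\<forall>v\<in>J. a j v = 0")
    case True
    obtain c where "\<exists>v\<in>J. c v \<noteq> 0" "\<forall>t<j. (\<Sum>v\<in>J. a t v * c v) = 0"
      using Suc.IH[of J a] Suc.prems by auto
    then show ?thesis using True by (intro exI[of _ c]) (auto simp: less_Suc_eq)
  next
    case False
    then obtain p where p: "p \<in> J" "a j p \<noteq> 0" by blast
    define J' where "J' = J - {p}"
    have J: "J = insert p J'" "p \<notin> J'" "finite J'" using p Suc.prems by (auto simp: J'_def)
    have "j < card J'" using Suc.prems J by simp
    from Suc.IH[OF J(3) this, of "\<lambda>t v. a t v - a t p * a j v / a j p"]
    obtain c where c: "\<exists>v\<in>J'. c v \<noteq> 0"
      "\<And>t. t < j \<Longrightarrow> (\<Sum>v\<in>J'. (a t v - a t p * a j v / a j p) * c v) = 0" by blast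
    define c' where "c' = c(p := - (\<Sum>v\<in>J'. a j v * c v) / a j p)"
    have "(\<Sum>v\<in>J. a t v * c' v) = (\<Sum>v\<in>J'. (a t v - a t p * a j v / a j p) * c v)" for t
    proof -
      have "(\<Sum>v\<in>J'. a t v * c' v) = (\<Sum>v\<in>J'. a t v * c v)"
        using J(2) by (intro sum.cong) (auto simp: c'_def)
      then show ?thesis using J(2,3)
        by (simp add: J(1) c'_def left_diff_distrib sum_subtractf sum_distrib_left sum_divide_distrib mult.assoc)
    qed
    moreover have "(\<Sum>v\<in>J'. (a j v - a j p * a j v / a j p) * c v) = 0"
      using p(2) by simp
    ultimately have "(\<Sum>v\<in>J. a t v * c' v) = 0" if "t < Suc j" for t
      using that c(2) by (cases "t = j") auto
    moreover have "\<exists>v\<in>J. c' v \<noteq> 0" using c(1) J by (auto simp: c'_def)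
    ultimately show ?thesis by blast
  qed
qed

subsection \<open>Linear subspaces of the nilpotency loci\<close>

locale nilpotent_space = quadrics_and_linear_forms N R k q b
  for N R k and q b :: "nat \<Rightarrow> 'a::field_char_0 mpoly" +
  assumes b_indep: "lin_indep k b"
    and nilpotent: "lincomb k b c ^ Suc k \<in> I"
    and k_pos: "0 < k"
begin

abbreviation L :: "(nat \<Rightarrow> 'a) \<Rightarrow> 'a mpoly" where "L \<equiv> lincomb k b"

lemma L_add: "L (\<lambda>i. c i + e i) = L c + L e"
  by (simp add: lincomb_def distrib_right sum.distrib)

lemma L_scale: "L (\<lambda>i. t * c i) = const t * L c"
  by (simp add: lincomb_def sum_distrib_left mult.assoc)

lemma L_line: "L c + const t * L e = L (\<lambda>i. c i + t * e i)"
  by (simp add: L_add L_scale)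

lemma L_unit: "j < k \<Longrightarrow> L (\<lambda>i. if i = j then 1 else 0) = b j"
proof -
  assume "j < k"
  have "L (\<lambda>i. if i = j then 1 else 0) = (\<Sum>i<k. if i = j then b i else 0)"
    unfolding lincomb_def by (intro sum.cong) auto
  then show ?thesis using \<open>j < k\<close> by simp
qed

lemma L_vars [simp]: "in_vars N (L c)"
  unfolding lincomb_def by (intro in_vars_sum in_vars_mult in_vars_const) (simp add: b_vars)

lemma L_homog: "homog 1 (L c)"
  unfolding lincomb_def by (intro homog_sum homog_const_mult) (simp add: b_homog del: One_nat_def)

lemma L_eq_0D: "L c = 0 \<Longrightarrow> i < k \<Longrightarrow> c i = 0"
  using b_indep by (auto simp: lincomb_def lin_indep_def)

lemma lin_closed_I: "lin_closed I"
  by (auto simp: lin_closed_def)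

lemma polarize_L:
  assumes "lin_closed V" "\<And>c. L c ^ Suc a * z \<in> V"
  shows "L c ^ a * L e * z \<in> V"
  by (rule polarize[OF assms(1)]) (simp only: L_line assms(2))

text \<open>Factors are split off the power one by one; \<open>z\<close> absorbs those already split
  off.\<close>

lemma polarize_prod:
  assumes V: "lin_closed V" and "\<And>c. L c ^ (j + m) * z \<in> V"
  shows "(\<Prod>i<j. L (C i)) * L y ^ m * z \<in> V"
  using assms(2)
proof (induction j arbitrary: z)
  case 0
  then show ?case by simp
next
  case (Suc j)
  have "L c ^ (j + m) * (L (C j) * z) \<in> V" for c
    using polarize_L[OF V, of "j + m" z c "C j"] Suc.prems by (simp add: mult.assoc)
  from Suc.IH[OF this] show ?case by (simp add: ac_simps)
qed

section \<open>Powers outside the ideal and the line they span\<close>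

lemma degree_1_in_I: "homog 1 x \<Longrightarrow> x \<in> I \<Longrightarrow> x = 0"
  using gen_ideal_hcomp_less[of x N q R 2 1] q_homog hcomp_homog[of 1 x] by simp

text \<open>Polarization trades one factor \<open>L c\<close> for each \<open>b i\<close>, so
  \<open>L c ^ m * L g\<close> is annihilated by all \<open>b i\<close> and lies in degree below
  \<open>k\<close>, hence in \<open>I\<close>. Descent ends with \<open>L g\<close> in
  \<open>I\<close>, which has no nonzero linear forms.\<close>

lemma linear_times_power_in_I:
  assumes "\<And>c. L c ^ m * L g \<in> I" "m < k"
  shows "L g = 0"
  using assms
proof (induction m)
  case 0
  then show ?case using degree_1_in_I[OF L_homog] by simp
next
  case (Suc m)
  have "L c ^ m * L g \<in> I" for c
  proof (rule annihilator_low_degree[of _ "m + 1"])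
    show "homog (m + 1) (L c ^ m * L g)" by (intro homog_mult homog_power L_homog)
    fix i assume i: "i < k"
    have "L c ^ m * b i * L g \<in> I"
      using polarize_L[OF lin_closed_I Suc.prems(1), of c "\<lambda>l. if l = i then 1 else 0"] L_unit[OF i] by simp
    then show "b i * (L c ^ m * L g) \<in> I" by (simp add: ac_simps)
  qed (use Suc.prems in auto)
  then show ?case by (rule Suc.IH) (use Suc.prems in simp)
qed

text \<open>Otherwise polarization and the preceding descent would force \<open>L g = 0\<close> for
  a unit vector \<open>g\<close>.\<close>

lemma ex_power_not_in_I: "\<exists>c. L c ^ k \<notin> I"
proof (rule ccontr)
  assume "\<not> ?thesis"
  then have all: "L c ^ Suc (k - 1) * 1 \<in> I" for c using k_pos by simp
  define g :: "nat \<Rightarrow> 'a" where "g = (\<lambda>i. if i = 0 then 1 else 0)"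
  have "L c ^ (k - 1) * L g \<in> I" for c
    using polarize_L[OF lin_closed_I all, of c g] by simp
  then have "L g = 0" by (rule linear_times_power_in_I) (use k_pos in simp)
  then have "g 0 = 0" using k_pos by (rule L_eq_0D)
  then show False by (simp add: g_def)
qed

definition socle_rep :: "'a mpoly" where
  "socle_rep = L (SOME c. L c ^ k \<notin> I) ^ k"

text \<open>The preimage of the line spanned by \<open>socle_rep\<close> in the quotient by
  \<open>I\<close>. The coordinate \<open>coord\<close> on it is well defined because
  \<open>socle_rep\<close> is outside \<open>I\<close>.\<close>

definition U :: "'a mpoly set" where
  "U = {u. \<exists>a. u - const a * socle_rep \<in> I}"

definition coord :: "'a mpoly \<Rightarrow> 'a" where
  "coord u = (THE a. u - const a * socle_rep \<in> I)"

lemma socle_rep_notin: "socle_rep \<notin> I"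
  unfolding socle_rep_def using someI_ex[OF ex_power_not_in_I] .

lemma coord_eqI:
  assumes "u - const a * socle_rep \<in> I" shows "coord u = a"
  unfolding coord_def
proof (rule the_equality[where P = "\<lambda>a. u - const a * socle_rep \<in> I", OF assms])
  fix a' assume "u - const a' * socle_rep \<in> I"
  from lin_closed_diff[OF lin_closed_I this assms]
  have "const (a - a') * socle_rep \<in> I" by (simp add: algebra_simps)
  then show "a' = a" using lin_closed_cancel[OF lin_closed_I, of "a - a'" socle_rep] socle_rep_notin by auto
qed

lemma U_iff: "u \<in> U \<longleftrightarrow> u - const (coord u) * socle_rep \<in> I"
  unfolding U_def using coord_eqI by auto

lemma coord_add: assumes "u \<in> U" "v \<in> U" shows "u + v \<in> U" "coord (u + v) = coord u + coord v"
proof -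
  have "(u - const (coord u) * socle_rep) + (v - const (coord v) * socle_rep) \<in> I"
    using assms unfolding U_iff by blast
  then have *: "(u + v) - const (coord u + coord v) * socle_rep \<in> I" by (simp add: algebra_simps)
  show "coord (u + v) = coord u + coord v" by (rule coord_eqI[OF *])
  show "u + v \<in> U" unfolding U_def using * by blast
qed

lemma coord_scale: assumes "u \<in> U" shows "const c * u \<in> U" "coord (const c * u) = c * coord u"
proof -
  have "const c * (u - const (coord u) * socle_rep) \<in> I"
    using assms unfolding U_iff by (intro gen_ideal_mult_left) simp_all
  then have *: "const c * u - const (c * coord u) * socle_rep \<in> I" by (simp add: algebra_simps)
  show "coord (const c * u) = c * coord u" by (rule coord_eqI[OF *])
  show "const c * u \<in> U" unfolding U_def using * by blast
qed

lemma coord_in_I: "u \<in> I \<Longrightarrow> coord u = 0" "u \<in> I \<Longrightarrow> u \<in> U"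
  using coord_eqI[of u 0] unfolding U_def by (auto intro!: exI[of _ 0])

lemma coord_eq_0_iff: "u \<in> U \<Longrightarrow> coord u = 0 \<longleftrightarrow> u \<in> I"
  using coord_in_I(1) unfolding U_iff by auto

lemma lin_closed_U: "lin_closed U"
  using coord_add coord_scale coord_in_I(2)[of 0] by (simp add: lin_closed_def)

lemma coord_sum: "finite X \<Longrightarrow> (\<And>x. x \<in> X \<Longrightarrow> f x \<in> U) \<Longrightarrow> coord (sum f X) = (\<Sum>x\<in>X. coord (f x))"
  by (induction X rule: finite_induct) (simp_all add: coord_in_I coord_add lin_closed_sum[OF lin_closed_U])

text \<open>\<open>L c ^ k\<close> and \<open>socle_rep\<close> are both annihilated by all
  \<open>b i\<close> in degree \<open>k\<close>, hence dependent modulo \<open>I\<close>; the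
  coefficient of \<open>L c ^ k\<close> is nonzero because \<open>socle_rep\<close> is not in
  \<open>I\<close>.\<close>

lemma power_in_U: "L c ^ k \<in> U"
proof -
  have ann: "b i * L c ^ k \<in> I" if i: "i < k" for i c
    using polarize_L[OF lin_closed_I, of k 1 c "\<lambda>l. if l = i then 1 else 0"] nilpotent L_unit[OF i]
    by (simp add: mult.commute)
  have w: "socle_rep = L (SOME c. L c ^ k \<notin> I) ^ k" by (rule socle_rep_def)
  obtain \<alpha> \<beta> where ab: "\<alpha> \<noteq> 0 \<or> \<beta> \<noteq> 0" "const \<alpha> * L c ^ k + const \<beta> * socle_rep \<in> I"
    using annihilator_critical_degree[OF in_vars_power[OF L_vars] homog_power[OF L_homog] ann
        in_vars_power[OF L_vars] homog_power[OF L_homog] ann]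
    unfolding w by blast
  have "\<alpha> \<noteq> 0"
  proof
    assume "\<alpha> = 0"
    then have "const \<beta> * socle_rep \<in> I" "\<beta> \<noteq> 0" using ab by auto
    then show False using lin_closed_cancel[OF lin_closed_I] socle_rep_notin by blast
  qed
  have "const (1 / \<alpha>) * (const \<alpha> * L c ^ k + const \<beta> * socle_rep) \<in> I"
    using ab(2) by (rule gen_ideal_mult_left) simp
  then have "L c ^ k - const (- \<beta> / \<alpha>) * socle_rep \<in> I"
    using \<open>\<alpha> \<noteq> 0\<close> by (simp add: distrib_left flip: mult.assoc const_mult)
  then show ?thesis unfolding U_def by blast
qed

lemma prod_in_U:
  assumes "j + m = k" shows "(\<Prod>i<j. L (C i)) * L y ^ m \<in> U"
  using polarize_prod[OF lin_closed_U, of j m 1 C y] power_in_U assms by simp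

text \<open>Restriction to a line gives a univariate polynomial whose linear coefficient is the
  derivative at \<open>t = 0\<close> in direction \<open>g\<close>.\<close>

lemma poly_of_curve:
  assumes z: "\<And>i. i \<le> m \<Longrightarrow> L c ^ (m - i) * L g ^ i * z \<in> U"
  shows "\<exists>p. (\<forall>t. poly p t = coord ((L c + const t * L g) ^ m * z)) \<and>
    coeff p 1 = of_nat m * coord (L c ^ (m - 1) * L g * z)"
proof -
  define a where "a = (\<lambda>i. of_nat (m choose i) * coord (L c ^ (m - i) * L g ^ i * z))"
  define p where "p = (\<Sum>i\<le>m. monom (a i) i)"
  have "coord ((L c + const t * L g) ^ m * z) = (\<Sum>i\<le>m. t ^ i * a i)" for t
    unfolding binomial_curve
    by (subst coord_sum) (simp_all add: a_def coord_scale z del: const_ring_simps)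
  then have "poly p t = coord ((L c + const t * L g) ^ m * z)" for t
    by (simp add: p_def poly_sum poly_monom mult.commute)
  moreover have "coeff p 1 = (if 1 \<le> m then a 1 else 0)"
    by (simp add: p_def coeff_sum coeff_monom)
  then have "coeff p 1 = of_nat m * coord (L c ^ (m - 1) * L g * z)"
    by (auto simp: a_def)
  ultimately show ?thesis by blast
qed

lemma power_form:
  "\<exists>F. F \<noteq> 0 \<and> in_vars k F \<and> homog k F \<and> (\<forall>c. L c ^ k \<in> I \<longleftrightarrow> meval F c = 0)"
proof -
  let ?S = "PiE {..<k} (\<lambda>_. {..<k})"
  define m where "m = (\<lambda>s. \<Prod>i<k. b (s i))"
  \<comment> \<open>The power is expanded over all maps \<open>s\<close> choosing one basis form per
    factor, and each product of basis forms is replaced by its coordinate.\<close>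
  define F where "F = (\<Sum>s\<in>?S. const (coord (m s)) * (\<Prod>i<k. var (s i)))"
  have fin: "finite ?S" by (intro finite_PiE) auto
  have mU: "m s \<in> U" if s: "s \<in> ?S" for s
  proof -
    have "m s = (\<Prod>i<k. L (\<lambda>l. if l = s i then 1 else 0)) * L (\<lambda>_. 0) ^ 0"
      unfolding m_def using PiE_mem[OF s] L_unit by (auto intro!: prod.cong)
    then show ?thesis using prod_in_U[of k 0] by simp
  qed
  have eval: "meval F c = coord (L c ^ k)" for c
  proof -
    have "L c ^ k = (\<Prod>i<k. \<Sum>j<k. const (c j) * b j)" by (simp add: lincomb_def)
    also have "\<dots> = (\<Sum>s\<in>?S. \<Prod>i<k. const (c (s i)) * b (s i))" by (rule prod_sum_PiE) auto
    also have "\<dots> = (\<Sum>s\<in>?S. const (\<Prod>i<k. c (s i)) * m s)"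
      by (simp add: prod.distrib const_prod m_def)
    also have "coord \<dots> = (\<Sum>s\<in>?S. (\<Prod>i<k. c (s i)) * coord (m s))"
      by (subst coord_sum[OF fin]) (auto simp: coord_scale mU)
    finally show ?thesis
      by (simp add: F_def meval_sum meval_mult meval_prod mult.commute)
  qed
  have "L c ^ k \<in> I \<longleftrightarrow> meval F c = 0" for c
    using coord_eq_0_iff[OF power_in_U] eval by simp
  moreover from this have "F \<noteq> 0"
    using ex_power_not_in_I meval_const[of 0] by auto
  moreover have "in_vars k F" unfolding F_def
    by (intro in_vars_sum in_vars_mult in_vars_const in_vars_prod in_vars_var) (auto dest: PiE_mem)
  moreover have "homog (card {..<k}) (\<Prod>i<k. var (s i) :: 'a mpoly)" for s
    by (rule homog_prod) (rule finite_lessThan homog_var)+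
  then have "homog k F" unfolding F_def by (intro homog_sum homog_const_mult) simp
  ultimately show ?thesis by blast
qed

section \<open>Nilpotent points away from hyperplanes\<close>

definition dot :: "(nat \<Rightarrow> 'a) \<Rightarrow> (nat \<Rightarrow> 'a) \<Rightarrow> 'a" where
  "dot l c = (\<Sum>i<k. l i * c i)"

lemma dot_add: "dot l (\<lambda>i. c i + e i) = dot l c + dot l e"
  by (simp add: dot_def distrib_left sum.distrib)

lemma dot_scale: "dot l (\<lambda>i. t * c i) = t * dot l c"
  by (simp add: dot_def sum_distrib_left mult.left_commute)

lemma dot_unit: "j < k \<Longrightarrow> dot l (\<lambda>i. if i = j then 1 else 0) = l j"
proof -
  assume "j < k"
  have "dot l (\<lambda>i. if i = j then 1 else 0) = (\<Sum>i<k. if i = j then l i else 0)"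
    unfolding dot_def by (intro sum.cong) auto
  then show ?thesis using \<open>j < k\<close> by simp
qed

text \<open>One of the two unit vectors works, or else their sum, since then each functional
  vanishes on the other's vector.\<close>

lemma dot_both_nonzero:
  assumes "i < k" "l i \<noteq> 0" "i' < k" "l' i' \<noteq> 0"
  shows "\<exists>z. dot l z \<noteq> 0 \<and> dot l' z \<noteq> 0"
proof (cases "l' i \<noteq> 0 \<or> l i' \<noteq> 0")
  case True
  then show ?thesis using assms dot_unit by metis
next
  case False
  then have "dot l (\<lambda>j. (if j = i then 1 else 0) + (if j = i' then 1 else 0)) \<noteq> 0"
    "dot l' (\<lambda>j. (if j = i then 1 else 0) + (if j = i' then 1 else 0)) \<noteq> 0"
    using assms by (simp_all add: dot_add dot_unit)
  then show ?thesis by blast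
qed

lemma linear_root_unique:
  assumes "(\<beta>::'a) \<noteq> 0" "\<alpha> + t * \<beta> = 0" shows "t = - \<alpha> / \<beta>"
  using assms by (simp add: field_simps eq_neg_iff_add_eq_0 add.commute)

text \<open>Otherwise the form \<open>c \<mapsto> coord (L c ^ k)\<close> would have no zero on lines in the direction \<open>g\<close> that
avoid both hyperplanes, hence be constant on them; its derivative along \<open>g\<close> would vanish.\<close>

lemma nilpotent_outside_hyperplanes:
  assumes alg: "alg_closed TYPE('a)"
    and l: "i < k" "l i \<noteq> 0" and l': "i' < k" "l' i' \<noteq> 0"
    and g: "v < k" "g v \<noteq> 0" "dot l g = 0" "dot l' g = 0"
  shows "\<exists>c. L c ^ k \<in> I \<and> dot l c \<noteq> 0 \<and> dot l' c \<noteq> 0"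
proof (rule ccontr)
  assume "\<not> ?thesis"
  then have H: "\<And>c. dot l c \<noteq> 0 \<Longrightarrow> dot l' c \<noteq> 0 \<Longrightarrow> L c ^ k \<notin> I" by blast
  have U1: "L c ^ (k - i) * L e ^ i \<in> U" if "i \<le> k" for c e i
    using prod_in_U[of "k - i" i "\<lambda>_. c" e] that by simp
  have generic: "L c ^ (k - 1) * L g \<in> I" if c: "dot l c \<noteq> 0" "dot l' c \<noteq> 0" for c
  proof -
    have u: "L c ^ (k - i) * L g ^ i * 1 \<in> U" if "i \<le> k" for i
      using U1[OF that] by simp
    from poly_of_curve[of k c g 1, OF u] obtain p where
      p: "\<And>t. poly p t = coord ((L c + const t * L g) ^ k)"
        "coeff p 1 = of_nat k * coord (L c ^ (k - 1) * L g)" by auto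
    have "poly p t \<noteq> 0" for t
    proof -
      have "dot l (\<lambda>i. c i + t * g i) \<noteq> 0" "dot l' (\<lambda>i. c i + t * g i) \<noteq> 0"
        using c g by (simp_all add: dot_add dot_scale)
      from H[OF this] show ?thesis using coord_eq_0_iff[OF power_in_U] by (simp add: p L_line)
    qed
    then have "degree p = 0" using alg unfolding alg_closed_def by blast
    then have "coeff p 1 = 0" by (intro coeff_eq_0) simp
    then have "coord (L c ^ (k - 1) * L g) = 0" using p(2) k_pos by simp
    then show ?thesis using coord_eq_0_iff U1[of 1 c g] k_pos by simp
  qed
  obtain z where z: "dot l z \<noteq> 0" "dot l' z \<noteq> 0" using dot_both_nonzero l l' by blast
  \<comment> \<open>Extension from generic \<open>c\<close> to all \<open>c\<close>: on the line
    through \<open>c\<close> in direction \<open>z\<close>, at most two parameters hit a hyperplane,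
    so the polynomial has infinitely many roots and vanishes also at \<open>t = 0\<close>.\<close>
  have all: "L c ^ (k - 1) * L g \<in> I" for c
  proof -
    have u: "L c ^ (k - 1 - i) * L z ^ i * L g \<in> U" if i: "i \<le> k - 1" for i
    proof -
      define C where "C = (\<lambda>j. if j < i then z else g)"
      have "(\<Prod>j<Suc i. L (C j)) = L z ^ i * L g" by (simp add: C_def)
      moreover have "Suc i + (k - 1 - i) = k" using i k_pos by simp
      ultimately show ?thesis using prod_in_U[of "Suc i" "k - 1 - i" C c] by (simp add: ac_simps)
    qed
    obtain p where p: "\<And>t. poly p t = coord ((L c + const t * L z) ^ (k - 1) * L g)"
      using poly_of_curve[of "k - 1" c z "L g", OF u] by auto
    have "poly p t = 0" if "t \<notin> {- dot l c / dot l z, - dot l' c / dot l' z}" for t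
    proof -
      have "dot l (\<lambda>i. c i + t * z i) \<noteq> 0" "dot l' (\<lambda>i. c i + t * z i) \<noteq> 0"
        using that z linear_root_unique by (auto simp: dot_add dot_scale)
      from generic[OF this] show ?thesis by (simp add: p L_line coord_in_I)
    qed
    then have "UNIV - {- dot l c / dot l z, - dot l' c / dot l' z} \<subseteq> {t. poly p t = 0}" by auto
    moreover have "infinite (UNIV - {- dot l c / dot l z, - dot l' c / dot l' z})"
      by (simp add: infinite_UNIV_char_0)
    ultimately have "p = 0" using poly_roots_finite[of p] finite_subset by blast
    then have "coord (L c ^ (k - 1) * L g) = 0" using p[of 0] by simp
    then show ?thesis using coord_eq_0_iff[of "L c ^ (k - 1) * L g"] u[of 0] by simp
  qed
  have "L g = 0" using all by (rule linear_times_power_in_I) (use k_pos in simp)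
  then show False using L_eq_0D g by blast
qed

lemma coord_dot:
  assumes "\<And>c. X * L c \<in> U"
  shows "coord (X * L c) = dot (\<lambda>i. coord (X * b i)) c"
proof -
  have "X * b i \<in> U" if "i < k" for i using assms[of "\<lambda>j. if j = i then 1 else 0"] that by (simp add: L_unit)
  then have "coord (\<Sum>i<k. const (c i) * (X * b i)) = (\<Sum>i<k. c i * coord (X * b i))"
    by (subst coord_sum) (simp_all add: coord_scale)
  moreover have "X * L c = (\<Sum>i<k. const (c i) * (X * b i))"
    by (simp add: lincomb_def sum_distrib_left mult.left_commute)
  ultimately show ?thesis by (simp add: dot_def mult.commute)
qed

text \<open>Completing the partial product by a power of some \<open>y\<close> keeps it in degree
  \<open>k\<close>, where nonvanishing can be tested by \<open>coord\<close>.\<close>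

lemma nilpotent_independent_prefix:
  assumes alg: "alg_closed TYPE('a)" and k2: "2 \<le> k" and "j \<le> k"
  shows "\<exists>C. (\<forall>i<j. L (C i) ^ k \<in> I) \<and>
    (\<forall>a. (\<forall>v<k. (\<Sum>i<j. a i * C i v) = 0) \<longrightarrow> (\<forall>i<j. a i = 0)) \<and>
    (\<exists>y. (\<Prod>i<j. L (C i)) * L y ^ (k - j) \<notin> I)"
  using assms(3)
proof (induction j)
  case 0
  then show ?case using ex_power_not_in_I by simp
next
  case (Suc j)
  then have jk: "j < k" by simp
  obtain C y where C: "\<And>i. i < j \<Longrightarrow> L (C i) ^ k \<in> I"
    "\<And>a. (\<forall>v<k. (\<Sum>i<j. a i * C i v) = 0) \<Longrightarrow> (\<forall>i<j. a i = 0)"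
    and y: "(\<Prod>i<j. L (C i)) * L y ^ (k - j) \<notin> I"
    using Suc by auto
  \<comment> \<open>One factor \<open>L y\<close> is released. The functional
    \<open>c \<mapsto> coord (X * L c)\<close>, called \<open>l\<close> below, is nonzero at
    \<open>y\<close>; any \<open>c\<close> with \<open>dot l c \<noteq> 0\<close> may take the free
    place.\<close>
  define X where "X = (\<Prod>i<j. L (C i)) * L y ^ (k - Suc j)"
  have XU: "X * L c \<in> U" for c
    using prod_in_U[of "Suc j" "k - Suc j" "C(j := c)" y] jk by (simp add: X_def ac_simps)
  define l where "l = (\<lambda>i. coord (X * b i))"
  have l: "coord (X * L c) = dot l c" for c unfolding l_def by (rule coord_dot[OF XU])
  have "L y ^ (k - j) = L y * L y ^ (k - Suc j)" using jk by (metis Suc_diff_Suc power_Suc)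
  then have "X * L y \<notin> I" using y by (simp add: X_def ac_simps)
  then have "dot l y \<noteq> 0" using l[of y] coord_eq_0_iff[OF XU[of y]] by simp
  then have l_nz: "\<exists>i<k. l i \<noteq> 0" by (auto simp: dot_def intro: ccontr)
  \<comment> \<open>\<open>l'\<close> vanishes on the points chosen so far, and \<open>g\<close> is
    a direction in both kernels. For \<open>k \<ge> 3\<close> two equations always leave such a
    \<open>g\<close>. For \<open>k = 2\<close> the choice \<open>l' = l\<close> works, because
    \<open>l\<close> at a previous point is the coordinate of its square, which is in
    \<open>I\<close>.\<close>
  obtain l' g where l': "\<exists>i<k. l' i \<noteq> 0" "\<And>i. i < j \<Longrightarrow> dot l' (C i) = 0"
    and g: "\<exists>v<k. g v \<noteq> 0" "dot l g = 0" "dot l' g = 0"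
  proof (cases "k = 2")
    case True
    have "dot l (C i) = 0" if "i < j" for i
    proof -
      have "i = 0" "j = 1" using that jk True by auto
      then have "X * L (C i) = L (C i) ^ k" using True by (simp add: X_def power2_eq_square)
      then show ?thesis using C(1)[OF that] coord_in_I(1) l[of "C i"] by simp
    qed
    moreover obtain g where "\<exists>v\<in>{..<k}. g v \<noteq> 0" "\<forall>t<1::nat. (\<Sum>v\<in>{..<k}. l v * g v) = 0"
      using underdetermined_system[of "{..<k}" 1 "\<lambda>_. l"] True by auto
    ultimately show thesis using that[of l g] l_nz by (auto simp: dot_def)
  next
    case False
    obtain l' where l': "\<exists>v\<in>{..<k}. l' v \<noteq> 0" "\<forall>t<j. (\<Sum>v\<in>{..<k}. C t v * l' v) = 0"
      using underdetermined_system[of "{..<k}" j C] jk by auto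
    obtain g where g: "\<exists>v\<in>{..<k}. g v \<noteq> 0"
      "\<forall>t<2::nat. (\<Sum>v\<in>{..<k}. (if t = 0 then l else l') v * g v) = 0"
      using underdetermined_system[of "{..<k}" 2 "\<lambda>t::nat. if t = 0 then l else l'"] False k2 by auto
    show thesis
      using l' g(1) g(2)[rule_format, of 0] g(2)[rule_format, of 1]
      by (intro that[of l' g]) (auto simp: dot_def mult.commute)
  qed
  from l_nz l'(1) g obtain c where c: "L c ^ k \<in> I" "dot l c \<noteq> 0" "dot l' c \<noteq> 0"
    using nilpotent_outside_hyperplanes[OF alg] by metis
  define C' where "C' = C(j := c)"
  have C': "C' i = C i" if "i < j" for i using that by (simp add: C'_def)
  have "a i = 0" if a: "\<forall>v<k. (\<Sum>i<Suc j. a i * C' i v) = 0" and i: "i < Suc j" for a i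
  proof -
    \<comment> \<open>Applying \<open>l'\<close> to a relation leaves only the new point's
      coefficient.\<close>
    have "0 = dot l' (\<lambda>v. \<Sum>i<Suc j. a i * C' i v)" using a by (simp add: dot_def)
    also have "\<dots> = (\<Sum>i<Suc j. a i * dot l' (C' i))"
      unfolding dot_def sum_distrib_left by (subst sum.swap) (simp add: mult.left_commute)
    also have "\<dots> = a j * dot l' c" using l'(2) C' by (simp add: C'_def)
    finally have "a j = 0" using c(3) by simp
    moreover from this have "\<forall>i<j. a i = 0" using a C' by (intro C(2)) simp
    ultimately show ?thesis using i by (auto simp: less_Suc_eq)
  qed
  moreover have "L (C' i) ^ k \<in> I" if "i < Suc j" for i
    using that C(1) c(1) by (auto simp: C'_def less_Suc_eq)
  moreover have "(\<Prod>i<Suc j. L (C' i)) * L y ^ (k - Suc j) \<notin> I"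
  proof -
    have "(\<Prod>i<Suc j. L (C' i)) * L y ^ (k - Suc j) = X * L c"
      using C' by (simp add: X_def C'_def ac_simps)
    then show ?thesis using c(2) l[of c] coord_in_I(1) by auto
  qed
  ultimately show ?case by (intro exI[of _ C']) blast
qed

lemma nilpotent_basis:
  assumes alg: "alg_closed TYPE('a)" and k2: "2 \<le> k"
  shows "\<exists>x. lin_indep k x \<and> (\<forall>i<k. (\<exists>c. x i = L c) \<and> x i ^ k \<in> I) \<and> (\<Prod>i<k. x i) \<notin> I"
proof -
  obtain C where C: "\<And>i. i < k \<Longrightarrow> L (C i) ^ k \<in> I"
    "\<And>a. (\<forall>v<k. (\<Sum>i<k. a i * C i v) = 0) \<Longrightarrow> (\<forall>i<k. a i = 0)" "(\<Prod>i<k. L (C i)) \<notin> I"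
    using nilpotent_independent_prefix[OF alg k2 order_refl] by auto
  have "lin_indep k (\<lambda>i. L (C i))"
    unfolding lin_indep_def
  proof (intro allI impI)
    fix a i assume a: "(\<Sum>i<k. const (a i) * L (C i)) = 0" and i: "i < k"
    have "(\<Sum>i<k. const (a i) * L (C i)) = L (\<lambda>v. \<Sum>i<k. a i * C i v)"
      unfolding lincomb_def const_sum sum_distrib_left sum_distrib_right
      by (subst sum.swap) (simp add: mult.assoc)
    then have "L (\<lambda>v. \<Sum>i<k. a i * C i v) = 0" using a by simp
    from L_eq_0D[OF this] have "\<forall>v<k. (\<Sum>i<k. a i * C i v) = 0" by blast
    then show "a i = 0" using C(2) i by blast
  qed
  then show ?thesis using C(1,3) by (intro exI[of _ "\<lambda>i. L (C i)"]) auto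
qed

end

theorem mainTheorem8:
  fixes q :: "nat \<Rightarrow> 'a::field_char_0 mpoly"
    and b :: "nat \<Rightarrow> 'a mpoly"
    and n k :: nat
  assumes alg: "alg_closed TYPE('a)"
    and quad: "\<forall>i\<le>n. in_vars (Suc n) (q i) \<and> homog 2 (q i)"
    and reg: "regular_seq (Suc n) q (Suc n)"
    and k: "k \<ge> 2"
    and lin: "\<forall>i<k. in_vars (Suc n) (b i) \<and> homog 1 (b i)"
    and indep: "lin_indep k b"
    and inN: "\<forall>c. lincomb k b c ^ (k + 1) \<in> gen_ideal (Suc n) q (Suc n)"
  shows "(\<exists>F :: 'a mpoly. F \<noteq> 0 \<and> in_vars k F \<and> homog k F \<and>
            (\<forall>c. lincomb k b c ^ k \<in> gen_ideal (Suc n) q (Suc n) \<longleftrightarrow> meval F c = 0))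
       \<and> (\<exists>x :: nat \<Rightarrow> 'a mpoly. lin_indep k x
            \<and> (\<forall>i<k. (\<exists>c. x i = lincomb k b c) \<and> x i ^ k \<in> gen_ideal (Suc n) q (Suc n))
            \<and> (\<Prod>i<k. x i) \<notin> gen_ideal (Suc n) q (Suc n))"
proof -
  \<comment> \<open>As many quadrics as variables; regularity of \<open>b\<close> comes from its
    linear independence.\<close>
  interpret nilpotent_space "Suc n" "Suc n" k q b
  proof
    fix j f assume f: "j < k" "in_vars (Suc n) f" "f * b j \<in> gen_ideal (Suc n) b j"
    show "f \<in> gen_ideal (Suc n) b j"
      by (rule linear_forms_regular[OF _ _ indep f]) (use lin in \<open>simp_all del: One_nat_def\<close>)
  next
    fix j f assume "j < Suc n" "in_vars (Suc n) f" "f * q j \<in> gen_ideal (Suc n) q j"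
    then show "f \<in> gen_ideal (Suc n) q j" using reg unfolding regular_seq_def by blast
  next
    fix c show "lincomb k b c ^ Suc k \<in> gen_ideal (Suc n) q (Suc n)" using inN by simp
  qed (use quad lin indep k in \<open>auto simp: less_Suc_eq_le simp del: One_nat_def\<close>)
  show ?thesis using power_form nilpotent_basis[OF alg k] by blast
qed

end
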